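(* Let $f:\mathbb{R}^{m\times n}\to\mathbb{R}$ be locally Lipschitz, let $\mathcal{D}_f:\mathbb{R}^{m\times n}\rightrightarrows\mathbb{R}^{m\times n}$ be a convex-valued conservative field for $f$, and suppose that $\{f(W):0\in\mathcal{D}_f(W)\}$ has empty interior in $\mathbb{R}$. Let $\tau>0$, and let $\{\eta_t\}_{t\ge0}$, $\{\delta_t\}_{t\ge0}\subseteq[0,1)$, $\{\sigma_t\}_{t\ge0}\subseteq[0,+\infty)$ satisfy $\eta_t>0$, $\eta_t\to0$, $\sum_{t=0}^\infty\eta_t=+\infty$, $\delta_t\to0$ and $\sup_{t\ge0}\sigma_t<+\infty$. Let $\beta_t=1-\tau\eta_t$, and let $\{(W_t,M_t)\}_{t\ge0}$ be generated, from some $(W_0,M_0)\in\mathbb{R}^{m\times n}\times\mathbb{R}^{m\times n}$, by the inexact Muon recursion $$G_t\in\mathcal{D}_f(W_t),\quad M_{t+1}=\beta_tM_t+(1-\beta_t)G_t,\quad \widetilde M_{t+1}=\tfrac{M_{t+1}}{\|M_{t+1}\|_F+\sigma_t},\quad W_{t+1}\in W_t-\eta_t\operatorname{polar}_{\delta_t}(\widetilde M_{t+1}),$$ with the convention $\widetilde M_{t+1}=0$ when $M_{t+1}=0$ and $\sigma_t=0$. If $\sup_t\|W_t\|_F<+\infty$, then every cluster point $\overline W$ of $\{W_t\}_{t\ge0}$ satisfies $0\in\mathcal{D}_f(\overline W)$, $M_t\to0$, and the sequence $\{f(W_t)\}_{t\ge0}$ converges. If in addition $f$ is convex and $\mathcal{D}_f=\partial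 f$ (the convex subdifferential), then $f(W_t)\to\inf_{W\in\mathbb{R}^{m\times n}}f(W)$ as $t\to+\infty$.
   Context: Conservative field: let $f:\mathbb{R}^{m\times n}\to\mathbb{R}$ be locally Lipschitz and let $\mathcal{D}_f:\mathbb{R}^{m\times n}\rightrightarrows\mathbb{R}^{m\times n}$ be a set-valued map with closed graph and nonempty compact values, which is locally bounded (every point has a neighborhood $V$ such that $\bigcup_{Y\in V}\mathcal{D}_f(Y)$ is bounded). $\mathcal{D}_f$ is a conservative field of $f$ if for every absolutely continuous $\gamma:[0,1]\to\mathbb{R}^{m\times n}$ and every measurable $v:[0,1]\to\mathbb{R}^{m\times n}$ with $v(t)\in\mathcal{D}_f(\gamma(t))$ for almost every $t\in[0,1]$, $$f(\gamma(1))-f(\gamma(0))=\int_0^1\langle\dot\gamma(t),v(t)\rangle\,dt,$$ where $\langle\cdot,\cdot\rangle$ is the Frobenius inner product. $\|\cdot\|_F$ is the Frobenius norm. Inexact polar map: for $\delta\in[0,1)$ and $Z\in\mathbb{R}^{m\times n}$ with $\|Z\|_F\le1$ and $r=\operatorname{rank}(Z)$, set $\operatorname{polar}_\delta(0):=\{0\}$ and, for $Z\ne0$, let $\operatorname{polar}_\delta(Z)$ be the set of all matrices $U\operatorname{Diag}(\phi_1,\dots,\phi_r)V^\top$ such that $Z=U\operatorname{Diag}(\sigma_1,\dots,\sigma_r)V^\top$ is a compact SVD of $Z$, $0\le\phi_j\le1+\delta$ for every $j$, and $\phi_j\ge1-\delta$ whenever $\sigma_j\ge\delta$. *)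

theory Defs
  imports "HOL-Analysis.Analysis"
begin

(* Matrices with m rows and n columns are elements of real ^ 'n ^ 'm.  The library norm and
   inner product on this type are the Frobenius ones. *)

definition locally_lipschitz :: "('a::metric_space \<Rightarrow> 'b::metric_space) \<Rightarrow> bool" where
  "locally_lipschitz f \<longleftrightarrow> (\<forall>x. \<exists>r>0. \<exists>L. L-lipschitz_on (ball x r) f)"

(* The library's absolutely_continuous is a relation between measures, hence the classical
   epsilon-delta definition here; it is meant for intervals S. *)
definition absolutely_continuous_on :: "real set \<Rightarrow> (real \<Rightarrow> 'a::metric_space) \<Rightarrow> bool" where
  "absolutely_continuous_on S \<gamma> \<longleftrightarrow>
     (\<forall>\<epsilon>>0. \<exists>\<delta>>0. \<forall>(N::nat) a b.
        (\<forall>i<N. a i \<le> b i \<and> a i \<in> S \<and> b i \<in> S) \<and>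
        disjoint_family_on (\<lambda>i. {a i<..<b i}) {..<N} \<and>
        (\<Sum>i<N. b i - a i) < \<delta> \<longrightarrow>
        (\<Sum>i<N. dist (\<gamma> (a i)) (\<gamma> (b i))) < \<epsilon>)"

(* An absolutely continuous curve is differentiable almost everywhere; the value of
   vector_derivative on the remaining null set does not affect the integral.  The integrand is
   integrable because the derivative is and D is locally bounded. *)
definition conservative_field ::
    "('a::euclidean_space \<Rightarrow> real) \<Rightarrow> ('a \<Rightarrow> 'a set) \<Rightarrow> bool" where
  "conservative_field f D \<longleftrightarrow>
     closed {(X, Y). Y \<in> D X} \<and>
     (\<forall>X. D X \<noteq> {} \<and> compact (D X)) \<and>
     (\<forall>X. \<exists>V. open V \<and> X \<in> V \<and> bounded (\<Union>Y\<in>V. D Y)) \<and>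
     (\<forall>\<gamma> v. absolutely_continuous_on {0..1} \<gamma> \<and>
            v \<in> borel_measurable (lebesgue_on {0..1}) \<and>
            (AE t in lebesgue_on {0..1}. v t \<in> D (\<gamma> t)) \<longrightarrow>
        f (\<gamma> 1) - f (\<gamma> 0) =
          (LINT t|lebesgue_on {0..1}. vector_derivative \<gamma> (at t within {0..1}) \<bullet> v t))"

definition convex_subdifferential :: "('a::real_inner \<Rightarrow> real) \<Rightarrow> 'a \<Rightarrow> 'a set" where
  "convex_subdifferential f X = {G. \<forall>Y. f Y \<ge> f X + G \<bullet> (Y - X)}"

(* A matrix with r columns, r depending on the data, is given by its columns
   U 0, ..., U (r - 1); values of U, V, \<phi> at indices \<ge> r are irrelevant. *)

definition orthonormal_columns :: "nat \<Rightarrow> (nat \<Rightarrow> 'a::real_inner) \<Rightarrow> bool" where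
  "orthonormal_columns r U \<longleftrightarrow> (\<forall>i<r. \<forall>j<r. U i \<bullet> U j = (if i = j then 1 else 0))"

(* The entries of U Diag(\<phi>) V^T *)
definition diag_product ::
    "nat \<Rightarrow> (nat \<Rightarrow> real ^ 'm) \<Rightarrow> (nat \<Rightarrow> real) \<Rightarrow> (nat \<Rightarrow> real ^ 'n) \<Rightarrow> real ^ 'n ^ 'm" where
  "diag_product r U \<phi> V = (\<chi> i k. \<Sum>j<r. U j $ i * \<phi> j * V j $ k)"

(* The singular values are not required to be sorted: permuting the triples (U j, s j, V j)
   does not change the set polar \<delta> Z below. *)
definition compact_svd ::
    "real ^ 'n ^ 'm \<Rightarrow> (nat \<Rightarrow> real ^ 'm) \<Rightarrow> (nat \<Rightarrow> real) \<Rightarrow> (nat \<Rightarrow> real ^ 'n) \<Rightarrow> bool" where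
  "compact_svd Z U s V \<longleftrightarrow>
     orthonormal_columns (rank Z) U \<and> orthonormal_columns (rank Z) V \<and>
     (\<forall>j<rank Z. s j > 0) \<and> Z = diag_product (rank Z) U s V"

(* Used for 0 \<le> \<delta> < 1 and norm Z \<le> 1 *)
definition polar :: "real \<Rightarrow> real ^ 'n ^ 'm \<Rightarrow> (real ^ 'n ^ 'm) set" where
  "polar \<delta> Z =
     (if Z = 0 then {0}
      else {diag_product (rank Z) U \<phi> V | U \<phi> V. \<exists>s. compact_svd Z U s V \<and>
              (\<forall>j<rank Z. 0 \<le> \<phi> j \<and> \<phi> j \<le> 1 + \<delta> \<and> (s j \<ge> \<delta> \<longrightarrow> \<phi> j \<ge> 1 - \<delta>))})"

definition normalized :: "real \<Rightarrow> 'a::real_normed_vector \<Rightarrow> 'a" where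
  "normalized \<sigma> M = (if M = 0 \<and> \<sigma> = 0 then 0 else M /\<^sub>R (norm M + \<sigma>))"

end

theory Submission
  imports Defs "HOL-Complex_Analysis.Great_Picard"
begin

text \<open>
  On the time scale of the step sizes, the iterates \<open>(W, M)\<close> shadow solutions of the differential
  inclusion \<open>W' \<in> - \<partial>N(M)\<close>, \<open>M' \<in> \<tau> (D(W) - M)\<close>, where \<open>N\<close> is the nuclear norm: limits of
  the inexact polar factors are subgradients of \<open>N\<close>, as their operator norm is at most 1 and
  their inner product with \<open>M\<close> is \<open>N(M)\<close>. Along a limit curve \<open>v = M + M'/\<tau>\<close> is a measurable
  selection of \<open>D(W)\<close>, so that conservativity gives \<open>f(W)' = W' \<bullet> v\<close>, while
  \<open>N(M)' = - W' \<bullet> M'\<close>. Hence \<open>f(W) + N(M)/\<tau>\<close> has derivative \<open>- N(M)\<close>, and it is strictly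
  decreasing unless the curve starts at a point with \<open>M = 0\<close> and \<open>0 \<in> D(W)\<close>. If this function
  oscillated along the iterates, they would cross a level that is not a critical value
  upwards infinitely often, and a limit curve starting on that level could not decrease.
\<close>

section \<open>Almost everywhere differentiability of Lipschitz curves\<close>

text \<open>Neither right-hand side of the inclusion is single-valued or continuous, so limits
  cannot simply be inserted there. Both have closed convex values, however, and membership in such a
  set is a family of half-space conditions; each of these survives summation over steps, the limit
  of the windows and differentiation (\<open>derivative_halfspace\<close>). This is where convexity
  of the values of \<open>D\<close> enters. Limit curves are only Lipschitz, so derivatives exist
  almost everywhere and must be chosen Borel to give a measurable selection. The Lyapunov function
  comes from splitting the product of \<open>W'\<close> with \<open>v = M + M'/\<tau>\<close>: the
  product with \<open>M\<close> is \<open>- N(M)\<close> by Euler's identity for the positively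
  homogeneous \<open>N\<close>, and the product with \<open>M'/\<tau>\<close> is
  \<open>- N(M)'/\<tau>\<close>; adding \<open>N(M)/\<tau>\<close> to \<open>f(W)\<close> cancels
  exactly the latter. Strict descent is known for limit curves only, not for single steps of the
  iterates. Convergence of the Lyapunov values therefore has to come from level crossings, and the
  empty interior of the critical values supplies a noncritical level in every gap between lower and
  upper limit.\<close>

text \<open>
  \<open>G x = F x + (L + 1) x\<close> is a bi-Lipschitz bijection, so \<open>A \<mapsto> \<lambda>(G ` A)\<close> is absolutely continuous
  with respect to Lebesgue measure \<open>\<lambda>\<close> and has a Radon-Nikodym density.
\<close>
lemma lipschitz_real_has_density:
  fixes F :: "real \<Rightarrow> real"
  assumes F: "L-lipschitz_on UNIV F"
  obtains g where "g \<in> borel_measurable borel"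
    and "\<And>a b. a \<le> b \<Longrightarrow> (g has_integral F b - F a) {a..b}"
proof -
  \<comment> \<open>The slope exceeds the Lipschitz constant by one, so \<open>G\<close> expands
    distances and its inverse is 1-Lipschitz, hence Borel.\<close>
  define G where "G x = F x + (L + 1) * x" for x
  have L0: "L \<ge> 0" using F lipschitz_on_nonneg by blast
  have FL: "\<bar>F y - F x\<bar> \<le> L * (y - x)" if "x \<le> y" for x y
    using lipschitz_onD[OF F, of y x] that by (simp add: dist_real_def)
  have G_lower: "y - x \<le> G y - G x" and G_upper: "G y - G x \<le> (2 * L + 1) * (y - x)" if "x \<le> y" for x y
    using FL[OF that] by (auto simp: G_def algebra_simps)
  have G_strict: "strict_mono G"
    by (rule strict_monoI) (use G_lower in \<open>smt (verit)\<close>)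
  have inj: "inj G" using G_strict strict_mono_imp_inj_on by blast
  have G_lip: "\<bar>G x - G y\<bar> \<le> (2 * L + 1) * \<bar>x - y\<bar>" for x y
  proof (cases "x \<le> y")
    case True
    then show ?thesis using G_upper[OF True] G_lower[OF True] by (simp add: abs_if algebra_simps)
  next
    case False
    then have "y \<le> x" by simp
    from G_upper[OF this] G_lower[OF this] this show ?thesis by (simp add: abs_if algebra_simps)
  qed
  have G_lip': "(2 * L + 1)-lipschitz_on UNIV G"
    by (rule lipschitz_onI) (use G_lip L0 in \<open>auto simp: dist_real_def\<close>)
  have G_cont: "continuous_on S G" for S
    using lipschitz_on_continuous_on[OF G_lip'] continuous_on_subset by blast
  have surj: "surj G"
  unfolding surj_def
  proof
    fix y
    define r where "r = \<bar>y - G 0\<bar>"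
    have "G (- r) \<le> y" "y \<le> G r"
      using G_lower[of 0 r] G_lower[of "- r" 0] by (auto simp: r_def)
    then obtain x where "G x = y"
      using IVT'[of G "- r" y r] G_cont r_def by (metis abs_ge_zero neg_le_0_iff_le order_trans)
    then show "\<exists>x. y = G x" by auto
  qed
  define H where "H = inv G"
  have GH: "G (H y) = y" and HG: "H (G x) = x" for x y
    using inj surj by (auto simp: H_def surj_f_inv_f)
  have "\<bar>H x - H y\<bar> \<le> \<bar>x - y\<bar>" for x y
    using G_lower[of "H x" "H y"] G_lower[of "H y" "H x"] by (auto simp: GH abs_if not_less)
  then have "1-lipschitz_on UNIV H"
    by (intro lipschitz_onI) (auto simp: dist_real_def)
  then have H_cont: "continuous_on UNIV H"
    using lipschitz_on_continuous_on by blast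
  then have H_meas[measurable]: "H \<in> borel_measurable borel"
    by (rule borel_measurable_continuous_onI)
  \<comment> \<open>Pushing Lebesgue measure forward along the inverse of \<open>G\<close> yields
    the measure of images under \<open>G\<close> with countable additivity built in.\<close>
  define N where "N = distr lborel borel H"
  have N_eq: "emeasure N A = emeasure lborel (G ` A)" if "A \<in> sets borel" for A :: "real set"
  proof -
    have "H -` A = G ` A" by (auto simp: HG) (metis GH imageI)
    then show ?thesis using that by (simp add: N_def emeasure_distr)
  qed
  have ac: "absolutely_continuous lborel N"
    unfolding absolutely_continuous_def
  proof
    fix A :: "real set" assume A: "A \<in> null_sets lborel"
    then have bor: "A \<in> sets borel" by (metis null_setsD2 sets_lborel)
    have "negligible A"
      using A by (simp add: negligible_iff_null_sets null_sets_completionI)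
    then have "negligible (G ` A)"
      by (rule negligible_locally_Lipschitz_image[rotated])
         (use G_lip in \<open>auto intro!: exI[of _ UNIV] exI[of _ "2 * L + 1"]\<close>)
    moreover have "G ` A = H -` A" by (auto simp: HG) (metis GH imageI)
    then have "G ` A \<in> sets borel"
      using measurable_sets[OF H_meas bor] by simp
    ultimately have "emeasure lborel (G ` A) = 0"
      by (simp add: negligible_iff_emeasure0)
    then show "A \<in> null_sets N"
      using N_eq[OF bor] bor by (simp add: null_sets_def N_def)
  qed
  obtain \<phi> where \<phi>: "\<phi> \<in> borel_measurable lborel" "density lborel \<phi> = N"
    using sigma_finite_measure.Radon_Nikodym[OF lborel.sigma_finite_measure_axioms ac] by (auto simp: N_def)
  have Gimg: "G ` {a..b} = {G a..G b}" for a b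
  proof
    show "G ` {a..b} \<subseteq> {G a..G b}" 
      using G_strict by (auto simp: strict_mono_less_eq)
    show "{G a..G b} \<subseteq> G ` {a..b}"
    proof
      fix y assume "y \<in> {G a..G b}"
      then have "H y \<in> {a..b}" using G_strict GH by (metis atLeastAtMost_iff strict_mono_less_eq)
      then show "y \<in> G ` {a..b}" using GH by (metis imageI)
    qed
  qed
  have int: "(\<integral>\<^sup>+x. \<phi> x * indicator {a..b} x \<partial>lborel) = ennreal (G b - G a)" if "a \<le> b" for a b
  proof -
    have "(\<integral>\<^sup>+x. \<phi> x * indicator {a..b} x \<partial>lborel) = emeasure N {a..b}"
      using \<phi> by (subst \<phi>(2)[symmetric], subst emeasure_density) auto
    also have "\<dots> = ennreal (G b - G a)"
      using that G_strict by (simp add: N_eq Gimg strict_mono_less_eq)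
    finally show ?thesis .
  qed
  \<comment> \<open>The Radon-Nikodym density may be infinite on a null set, where
    \<open>enn2real\<close> returns 0; finiteness of the integral over \<open>{a..b}\<close> makes
    the change invisible.\<close>
  define g where "g x = enn2real (\<phi> x)" for x
  have g_meas[measurable]: "g \<in> borel_measurable borel"
    using \<phi>(1) unfolding g_def by measurable
  have g_nonneg: "g x \<ge> 0" for x by (simp add: g_def)
  have "(g has_integral G b - G a) {a..b}" if ab: "a \<le> b" for a b
  proof -
    have "AE x in lborel. \<phi> x * indicator {a..b} x \<noteq> \<infinity>"
      by (rule nn_integral_PInf_AE) (use \<phi> int[OF ab] in auto)
    then have "AE x in lborel. ennreal (g x * indicator {a..b} x) = \<phi> x * indicator {a..b} x"
      by eventually_elim (auto simp: g_def indicator_def less_top)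
    then have "(\<integral>\<^sup>+x. ennreal (g x * indicator {a..b} x) \<partial>lborel) = ennreal (G b - G a)"
      using int[OF ab] nn_integral_cong_AE by metis
    then have "((\<lambda>x. g x * indicator {a..b} x) has_integral G b - G a) UNIV"
      by (intro nn_integral_has_integral) (use ab G_strict g_nonneg in \<open>auto simp: strict_mono_less_eq intro!: borel_measurable_times\<close>)
    moreover have "(\<lambda>x. g x * indicator {a..b} x) = (\<lambda>x. if x \<in> {a..b} then g x else 0)"
      by (auto simp: indicator_def)
    ultimately show ?thesis
      using has_integral_restrict_UNIV[of "{a..b}" g] by simp
  qed
  then have *: "((\<lambda>x. g x - (L + 1)) has_integral (G b - G a) - (L + 1) * (b - a)) {a..b}" if "a \<le> b" for a b
    using has_integral_diff[OF _ has_integral_const_real[of "L+1" a b]] that by (simp add: mult.commute)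
  show thesis
  proof
    show "(\<lambda>x. g x - (L + 1)) \<in> borel_measurable borel" by measurable
    show "((\<lambda>x. g x - (L + 1)) has_integral F b - F a) {a..b}" if "a \<le> b" for a b
      using *[OF that] by (simp add: G_def algebra_simps)
  qed
qed

text \<open>Lebesgue differentiation. The cubes in \<open>integrable_ccontinuous_explicit\<close>
  have \<open>x\<close> as their lower corner, so only right-hand quotients come out.\<close>

lemma density_imp_right_derivative:
  fixes F g :: "real \<Rightarrow> real"
  assumes "\<And>a b. a \<le> b \<Longrightarrow> (g has_integral F b - F a) {a..b}"
  shows "\<exists>N. negligible N \<and>
    (\<forall>x. x \<notin> N \<longrightarrow> ((\<lambda>y. (F y - F x) / (y - x)) \<longlongrightarrow> g x) (at_right x))"
proof -
  have "g integrable_on cbox a b" for a b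
  proof (cases "a \<le> b")
    case True
    then show ?thesis using assms by fastforce
  qed auto
  then obtain N where N: "negligible N" and 
    lim: "\<And>x e. \<lbrakk>x \<notin> N; 0 < e\<rbrakk> \<Longrightarrow> \<exists>d>0. \<forall>h. 0 < h \<and> h < d \<longrightarrow>
        norm (integral (cbox x (x + h *\<^sub>R One)) g /\<^sub>R h ^ DIM(real) - g x) < e"
    by (rule integrable_ccontinuous_explicit) blast
  show ?thesis
  proof (intro exI conjI allI impI)
    show "negligible N" by (rule N)
    fix x assume x: "x \<notin> N"
    show "((\<lambda>y. (F y - F x) / (y - x)) \<longlongrightarrow> g x) (at_right x)"
    proof (rule tendstoI)
      fix e :: real assume "e > 0"
      then obtain d where "d > 0" and 
        d: "\<And>h. 0 < h \<Longrightarrow> h < d \<Longrightarrow> norm (integral (cbox x (x + h *\<^sub>R One)) g /\<^sub>R h ^ DIM(real) - g x) < e"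
        using lim[OF x] by metis
      have "dist ((F y - F x) / (y - x)) (g x) < e" if "x < y" "y < x + d" for y
      proof -
        have "integral {x..y} g = F y - F x" using assms[of x y] that by (simp add: integral_unique)
        then show ?thesis using d[of "y - x"] that by (simp add: dist_real_def divide_inverse mult.commute)
      qed
      then show "\<forall>\<^sub>F y in at_right x. dist ((F y - F x) / (y - x)) (g x) < e"
        using \<open>d > 0\<close> by (auto simp: eventually_at_right_field intro!: exI[of _ "x+d"])
    qed
  qed
qed

text \<open>Left-hand quotients are the right-hand quotients of the reflected function
  \<open>- F (- x)\<close>, whose density is \<open>g (- x)\<close>; reflection preserves null
  sets.\<close>

lemma density_imp_derivative:
  fixes F g :: "real \<Rightarrow> real"
  assumes g: "\<And>a b. a \<le> b \<Longrightarrow> (g has_integral F b - F a) {a..b}"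
  obtains N where "negligible N" and "\<And>x. x \<notin> N \<Longrightarrow> (F has_real_derivative g x) (at x)"
proof -
  obtain N1 where N1: "negligible N1"
    and R: "\<And>x. x \<notin> N1 \<Longrightarrow> ((\<lambda>y. (F y - F x) / (y - x)) \<longlongrightarrow> g x) (at_right x)"
    using density_imp_right_derivative[OF g] by auto
  have "((\<lambda>x. g (- x)) has_integral (- F (- b) - - F (- a))) {a..b}" if "a \<le> b" for a b
    using g[of "-b" "-a"] that by (subst has_integral_reflect_real[symmetric]) simp
  then obtain N2 where N2: "negligible N2"
    and L: "\<And>x. x \<notin> N2 \<Longrightarrow> ((\<lambda>y. (- F (- y) - - F (- x)) / (y - x)) \<longlongrightarrow> g (- x)) (at_right x)"
    using density_imp_right_derivative[where g = "\<lambda>x. g (- x)" and F = "\<lambda>x. - F (- x)"] by blast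
  show thesis
  proof
    show "negligible (N1 \<union> uminus ` N2)"
    proof (intro negligible_Un N1)
      have "\<exists>T B. open T \<and> x \<in> T \<and> (\<forall>y\<in>N2 \<inter> T. norm (- y - - x) \<le> B * norm (y - x))" for x
        by (intro exI[of _ UNIV] exI[of _ "1::real"]) (simp add: abs_minus_commute)
      then show "negligible (uminus ` N2)"
        using N2 by (intro negligible_locally_Lipschitz_image) auto
    qed
    fix x assume x: "x \<notin> N1 \<union> uminus ` N2"
    then have "- x \<notin> N2" by (metis UnI2 image_eqI minus_minus)
    from L[OF this] have "((\<lambda>y. (F y - F x) / (y - x)) \<longlongrightarrow> g x) (at_left x)"
      unfolding at_left_minus[of x] filterlim_filtermap
      by (auto elim!: Lim_transform_eventually intro!: always_eventually simp: divide_simps)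
        (auto simp: algebra_simps)
    with R x show "(F has_real_derivative g x) (at x)"
      unfolding has_field_derivative_iff by (simp add: filterlim_split_at)
  qed
qed

text \<open>Pairing \<open>Z\<close> with the fixed vector \<open>d\<close> reduces the claim to
  real difference quotients: they are at most \<open>norm d * L\<close> and tend to the square of
  \<open>norm d\<close>.\<close>

lemma lipschitz_vector_derivative_bound:
  fixes Z :: "real \<Rightarrow> 'a::real_inner"
  assumes Z: "L-lipschitz_on UNIV Z" and d: "(Z has_vector_derivative d) (at s)"
  shows "norm d \<le> L"
proof (cases "d = 0")
  case True
  then show ?thesis using Z lipschitz_on_nonneg by auto
next
  case False
  have "((\<lambda>y. d \<bullet> Z y) has_real_derivative d \<bullet> d) (at s)"
    using bounded_linear.has_vector_derivative[OF bounded_linear_inner_right d]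
    by (simp add: has_real_derivative_iff_has_vector_derivative)
  then have lim: "((\<lambda>y. (d \<bullet> Z y - d \<bullet> Z s) / (y - s)) \<longlongrightarrow> d \<bullet> d) (at s)"
    unfolding has_field_derivative_iff .
  have "(d \<bullet> Z y - d \<bullet> Z s) / (y - s) \<le> norm d * L" if "y \<noteq> s" for y
  proof -
    have "\<bar>d \<bullet> (Z y - Z s)\<bar> \<le> norm d * norm (Z y - Z s)" by (rule Cauchy_Schwarz_ineq2)
    also have "\<dots> \<le> norm d * (L * \<bar>y - s\<bar>)"
      using lipschitz_onD[OF Z, of y s] by (intro mult_left_mono) (auto simp: dist_norm)
    finally have "\<bar>(d \<bullet> Z y - d \<bullet> Z s) / (y - s)\<bar> \<le> norm d * L"
      using that by (simp add: inner_diff_right divide_le_eq mult_ac)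
    then show ?thesis by linarith
  qed
  then have "\<forall>\<^sub>F y in at s. (d \<bullet> Z y - d \<bullet> Z s) / (y - s) \<le> norm d * L"
    by (auto simp: eventually_at intro: exI[of _ 1])
  from tendsto_upperbound[OF lim this] have "norm d * norm d \<le> norm d * L"
    by (simp add: power2_norm_eq_inner[symmetric] power2_eq_square)
  then show ?thesis using False by simp
qed

text \<open>The one-dimensional Rademacher theorem with the fundamental theorem of calculus,
  obtained coordinate by coordinate.\<close>

proposition lipschitz_imp_AE_vector_derivative:
  fixes Z :: "real \<Rightarrow> 'a::euclidean_space"
  assumes Z: "L-lipschitz_on UNIV Z"
  obtains g N where "g \<in> borel_measurable borel" "negligible N" "\<And>x. norm (g x) \<le> L"
    and "\<And>x. x \<notin> N \<Longrightarrow> (Z has_vector_derivative g x) (at x)"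
    and "\<And>a b. a \<le> b \<Longrightarrow> (g has_integral Z b - Z a) {a..b}"
proof -
  have "\<exists>g N. g \<in> borel_measurable borel \<and> (\<forall>a b. a \<le> b \<longrightarrow> (g has_integral Z b \<bullet> e - Z a \<bullet> e) {a..b}) \<and> 
     negligible N \<and> (\<forall>x. x \<notin> N \<longrightarrow> ((\<lambda>x. Z x \<bullet> e) has_real_derivative g x) (at x))" if e: "e \<in> Basis" for e
  proof -
    have "L-lipschitz_on UNIV (\<lambda>x. Z x \<bullet> e)"
    proof (rule lipschitz_onI)
      fix x y 
      have "\<bar>(Z x - Z y) \<bullet> e\<bar> \<le> norm (Z x - Z y)" using Basis_le_norm[OF e] by blast
      also have "\<dots> \<le> L * dist x y" using lipschitz_onD[OF Z, of x y] by (simp add: dist_norm)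
      finally show "dist (Z x \<bullet> e) (Z y \<bullet> e) \<le> L * dist x y" by (simp add: dist_real_def inner_diff_left)
    qed (use Z lipschitz_on_nonneg in blast)
    then obtain g where g: "g \<in> borel_measurable borel"
      "\<And>a b. a \<le> b \<Longrightarrow> (g has_integral Z b \<bullet> e - Z a \<bullet> e) {a..b}"
      by (rule lipschitz_real_has_density) blast
    then show ?thesis using density_imp_derivative[of g "\<lambda>x. Z x \<bullet> e"] by metis
  qed
  then obtain g N where g: "\<And>e. e \<in> Basis \<Longrightarrow> g e \<in> borel_measurable borel"
    "\<And>e a b. e \<in> Basis \<Longrightarrow> a \<le> b \<Longrightarrow> (g e has_integral Z b \<bullet> e - Z a \<bullet> e) {a..b}"
    and N: "\<And>e. e \<in> Basis \<Longrightarrow> negligible (N e)"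
    "\<And>e x. e \<in> Basis \<Longrightarrow> x \<notin> N e \<Longrightarrow> ((\<lambda>x. Z x \<bullet> e) has_real_derivative g e x) (at x)"
    by metis
  define G where "G x = (\<Sum>e\<in>Basis. g e x *\<^sub>R e)" for x
  \<comment> \<open>Off the exceptional set the bound \<open>L\<close> holds anyway; truncating
    makes it hold everywhere without losing Borel measurability.\<close>
  define G' where "G' x = (if norm (G x) \<le> L then G x else 0)" for x
  have [measurable]: "G \<in> borel_measurable borel" unfolding G_def using g(1) by measurable
  have neg: "negligible (\<Union> (N ` Basis))" using N(1) by (intro negligible_Union) auto
  have deriv: "(Z has_vector_derivative G x) (at x)" if "x \<notin> \<Union> (N ` Basis)" for x
  proof -
    have "((\<lambda>x. \<Sum>e\<in>Basis. (Z x \<bullet> e) *\<^sub>R e) has_vector_derivative G x) (at x)"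
      unfolding G_def
    proof (rule has_vector_derivative_sum)
      fix e :: 'a assume "e \<in> Basis"
      then have "((\<lambda>x. Z x \<bullet> e) has_real_derivative g e x) (at x)" using N(2) that by blast
      then show "((\<lambda>x. (Z x \<bullet> e) *\<^sub>R e) has_vector_derivative g e x *\<^sub>R e) (at x)"
        using has_vector_derivative_scaleR[OF _ has_vector_derivative_const[of e]] by fastforce
    qed
    then show ?thesis by (simp add: euclidean_representation)
  qed
  have G_eq: "G' x = G x" if "x \<notin> \<Union> (N ` Basis)" for x
    using lipschitz_vector_derivative_bound[OF Z deriv[OF that]] by (simp add: G'_def)
  show thesis
  proof
    show "G' \<in> borel_measurable borel" unfolding G'_def by measurable
    show "negligible (\<Union> (N ` Basis))" by (rule neg)
    show "norm (G' x) \<le> L" for x using Z lipschitz_on_nonneg by (auto simp: G'_def)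
    show "(Z has_vector_derivative G' x) (at x)" if "x \<notin> \<Union> (N ` Basis)" for x
      using deriv[OF that] G_eq[OF that] by simp
    show "(G' has_integral Z b - Z a) {a..b}" if "a \<le> b" for a b
    proof -
      have "(G has_integral (\<Sum>e\<in>Basis. (Z b \<bullet> e - Z a \<bullet> e) *\<^sub>R e)) {a..b}"
        unfolding G_def by (intro has_integral_sum has_integral_scaleR_left g(2) that) auto
      then have "(G has_integral Z b - Z a) {a..b}"
        by (simp add: inner_diff_left[symmetric] euclidean_representation)
      then show ?thesis using has_integral_spike[OF neg] G_eq by blast
    qed
  qed
qed

section \<open>The nuclear norm and the inexact polar map\<close>

definition op_unit_ball :: "(real ^ 'n ^ 'm) set" where
  "op_unit_ball = {P. \<forall>x y. \<bar>x \<bullet> (P *v y)\<bar> \<le> norm x * norm y}"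

text \<open>The dual norm of the operator norm. In this form subadditivity, homogeneity and the
  Lipschitz bound are immediate, and a member of the ball that attains the supremum at
  \<open>Y\<close> is by definition a subgradient at \<open>Y\<close>.\<close>

definition nuclear_norm :: "real ^ 'n ^ 'm \<Rightarrow> real" where
  "nuclear_norm Y = (SUP P\<in>op_unit_ball. P \<bullet> Y)"

lemma inner_matrix_vector_le:
  fixes P :: "real ^ 'n ^ 'm" and x :: "real ^ 'm"
  shows "\<bar>x \<bullet> (P *v y)\<bar> \<le> norm P * (norm x * norm y)"
proof -
  have "\<bar>(P *v y) $ i\<bar> \<le> norm (P $ i) * norm y" for i
    using Cauchy_Schwarz_ineq2[of "P $ i" y] by (simp add: matrix_vector_mul_component)
  then have "norm (P *v y) \<le> L2_set (\<lambda>i. norm (P $ i) * norm y) UNIV"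
    unfolding norm_vec_def[of "P *v y"] by (intro L2_set_mono) auto
  also have "\<dots> = norm P * norm y"
    by (simp add: norm_vec_def[of P] L2_set_left_distrib)
  finally have "norm (P *v y) \<le> norm P * norm y" .
  then have "norm x * norm (P *v y) \<le> norm x * (norm P * norm y)"
    by (intro mult_left_mono) auto
  with Cauchy_Schwarz_ineq2[of x "P *v y"] show ?thesis by (simp add: algebra_simps)
qed

lemma op_unit_ballI:
  fixes P :: "real ^ 'n ^ 'm"
  shows "norm P \<le> 1 \<Longrightarrow> P \<in> op_unit_ball"
  unfolding op_unit_ball_def
proof (clarify)
  fix x :: "real ^ 'm" and y :: "real ^ 'n" assume "norm P \<le> 1"
  then have "norm P * (norm x * norm y) \<le> 1 * (norm x * norm y)"
    by (intro mult_right_mono) auto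
  then show "\<bar>x \<bullet> (P *v y)\<bar> \<le> norm x * norm y"
    using inner_matrix_vector_le[of x P y] by simp
qed

text \<open>Testing with pairs of coordinate vectors bounds every entry by 1. The dimensional
  constant is crude; it only feeds boundedness and Lipschitz estimates.\<close>

lemma op_unit_ball_norm_le:
  fixes P :: "real ^ 'n ^ 'm"
  assumes "P \<in> op_unit_ball"
  shows "norm P \<le> CARD('m) * CARD('n)"
proof -
  have entry: "\<bar>P $ i $ k\<bar> \<le> 1" for i k
  proof -
    have "\<bar>axis i 1 \<bullet> (P *v axis k 1)\<bar> \<le> norm (axis i (1::real) :: real^'m) * norm (axis k (1::real) :: real^'n)"
      using assms unfolding op_unit_ball_def by blast
    then show ?thesis
      by (simp add: inner_axis' matrix_vector_mult_basis column_def norm_axis_1)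
  qed
  have "norm P \<le> (\<Sum>i\<in>UNIV. norm (P $ i))"
    unfolding norm_vec_def by (intro L2_set_le_sum) auto
  also have "\<dots> \<le> (\<Sum>i\<in>(UNIV::'m set). real CARD('n))"
  proof (rule sum_mono)
    fix i
    have "norm (P $ i) \<le> (\<Sum>k\<in>UNIV. \<bar>P $ i $ k\<bar>)"
      by (rule norm_le_l1_cart)
    also have "\<dots> \<le> (\<Sum>k\<in>(UNIV::'n set). 1)" by (intro sum_mono entry)
    finally show "norm (P $ i) \<le> CARD('n)" by simp
  qed
  finally show ?thesis by simp
qed

lemma op_unit_ball_inner_le:
  fixes P Y :: "real ^ 'n ^ 'm"
  assumes "P \<in> op_unit_ball"
  shows "P \<bullet> Y \<le> CARD('m) * CARD('n) * norm Y"
  using norm_cauchy_schwarz[of P Y] mult_right_mono[OF op_unit_ball_norm_le[OF assms] norm_ge_zero[of Y]]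
  by linarith

lemma bdd_above_op_unit_ball_inner: "bdd_above ((\<lambda>P. P \<bullet> Y) ` op_unit_ball)"
  by (rule bdd_aboveI2[OF op_unit_ball_inner_le])

lemma inner_le_nuclear_norm: "P \<in> op_unit_ball \<Longrightarrow> P \<bullet> Y \<le> nuclear_norm Y"
  unfolding nuclear_norm_def by (rule cSUP_upper[OF _ bdd_above_op_unit_ball_inner])

lemma nuclear_norm_le: "(\<And>P. P \<in> op_unit_ball \<Longrightarrow> P \<bullet> Y \<le> c) \<Longrightarrow> nuclear_norm Y \<le> c"
  unfolding nuclear_norm_def by (rule cSUP_least) (use op_unit_ballI[of 0] in auto)

lemma nuclear_norm_0 [simp]: "nuclear_norm 0 = 0"
proof (rule antisym)
  show "nuclear_norm (0 :: real ^ 'a ^ 'b) \<le> 0" by (rule nuclear_norm_le) simp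
  show "0 \<le> nuclear_norm (0 :: real ^ 'a ^ 'b)"
    using inner_le_nuclear_norm[OF op_unit_ballI[of "0 :: real ^ 'a ^ 'b"], of 0] by simp
qed

text \<open>The normalized matrix is itself an admissible test. Through this bound a vanishing
  nuclear norm forces a vanishing momentum in \<open>descent\<close>.\<close>

lemma norm_le_nuclear_norm: "norm Y \<le> nuclear_norm Y"
proof (cases "Y = 0")
  case False
  then have "(Y /\<^sub>R norm Y) \<bullet> Y = norm Y"
    by (simp add: power2_norm_eq_inner[symmetric] power2_eq_square)
  moreover have "Y /\<^sub>R norm Y \<in> op_unit_ball"
    using False by (intro op_unit_ballI) simp
  ultimately show ?thesis using inner_le_nuclear_norm by metis
qed simp

lemma nuclear_norm_triangle: "nuclear_norm (X + Y) \<le> nuclear_norm X + nuclear_norm Y"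
  by (rule nuclear_norm_le) (auto simp: inner_add_right intro!: add_mono inner_le_nuclear_norm)

lemma nuclear_norm_scale_le: "c \<ge> 0 \<Longrightarrow> nuclear_norm (c *\<^sub>R Y) \<le> c * nuclear_norm Y"
  by (rule nuclear_norm_le) (auto intro!: mult_left_mono inner_le_nuclear_norm)

lemma nuclear_norm_le_norm:
  fixes Y :: "real ^ 'n ^ 'm"
  shows "nuclear_norm Y \<le> CARD('m) * CARD('n) * norm Y"
  by (rule nuclear_norm_le[OF op_unit_ball_inner_le])

lemma nuclear_norm_lipschitz:
  fixes X Y :: "real ^ 'n ^ 'm"
  shows "\<bar>nuclear_norm X - nuclear_norm Y\<bar> \<le> CARD('m) * CARD('n) * norm (X - Y)"
  using nuclear_norm_triangle[of Y "X - Y"] nuclear_norm_triangle[of X "Y - X"]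
    nuclear_norm_le_norm[of "X - Y"] nuclear_norm_le_norm[of "Y - X"]
  by (auto simp: norm_minus_commute)

section \<open>Diagonal products of orthonormal families and the inexact polar factor\<close>

lemma bessel_inequality:
  fixes U :: "nat \<Rightarrow> 'a::real_inner"
  assumes "orthonormal_columns r U"
  shows "(\<Sum>j<r. (x \<bullet> U j)\<^sup>2) \<le> (norm x)\<^sup>2"
proof -
  define p where "p = (\<Sum>j<r. (x \<bullet> U j) *\<^sub>R U j)"
  have xp: "x \<bullet> p = (\<Sum>j<r. (x \<bullet> U j)\<^sup>2)"
    by (simp add: p_def inner_sum_right power2_eq_square)
  have Up: "U j \<bullet> p = x \<bullet> U j" if "j < r" for j
  proof -
    have "U j \<bullet> p = (\<Sum>i<r. (x \<bullet> U i) * (if j = i then 1 else 0))"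
      unfolding p_def inner_sum_right
      using assms that by (intro sum.cong) (auto simp: orthonormal_columns_def)
    then show ?thesis using that by (simp add: if_distrib cong: if_cong)
  qed
  have pp: "p \<bullet> p = (\<Sum>j<r. (x \<bullet> U j)\<^sup>2)"
    by (subst p_def) (simp add: inner_sum_left Up power2_eq_square)
  have "0 \<le> (x - p) \<bullet> (x - p)" by simp
  also have "\<dots> = x \<bullet> x - (\<Sum>j<r. (x \<bullet> U j)\<^sup>2)"
    using xp pp by (simp add: inner_diff_left inner_diff_right inner_commute)
  finally show ?thesis by (simp add: power2_norm_eq_inner)
qed

lemma inner_diag_product:
  "x \<bullet> (diag_product r U \<phi> V *v y) = (\<Sum>j<r. (x \<bullet> U j) * \<phi> j * (V j \<bullet> y))"
proof -
  have "x \<bullet> (diag_product r U \<phi> V *v y) = (\<Sum>i\<in>UNIV. \<Sum>k\<in>UNIV. \<Sum>j<r. x $ i * (U j $ i * \<phi> j * V j $ k * y $ k))"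
    by (simp add: inner_vec_def matrix_vector_mult_def diag_product_def sum_distrib_left sum_distrib_right)
  also have "\<dots> = (\<Sum>j<r. \<Sum>i\<in>UNIV. \<Sum>k\<in>UNIV. x $ i * (U j $ i * \<phi> j * V j $ k * y $ k))"
    by (rule trans[OF sum.cong[OF refl sum.swap] sum.swap])
  also have "\<dots> = (\<Sum>j<r. (x \<bullet> U j) * \<phi> j * (V j \<bullet> y))"
    by (intro sum.cong refl) (simp add: inner_vec_def sum_distrib_left sum_distrib_right mult_ac)
  finally show ?thesis .
qed

lemma matrix_inner_diag_product:
  "Q \<bullet> diag_product r U s V = (\<Sum>j<r. s j * (U j \<bullet> (Q *v V j)))"
proof -
  have "Q \<bullet> diag_product r U s V = (\<Sum>i\<in>UNIV. \<Sum>k\<in>UNIV. \<Sum>j<r. s j * (U j $ i * (Q $ i $ k * V j $ k)))"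
    by (simp add: inner_vec_def diag_product_def sum_distrib_left mult_ac)
  also have "\<dots> = (\<Sum>j<r. \<Sum>i\<in>UNIV. \<Sum>k\<in>UNIV. s j * (U j $ i * (Q $ i $ k * V j $ k)))"
    by (rule trans[OF sum.cong[OF refl sum.swap] sum.swap])
  also have "\<dots> = (\<Sum>j<r. s j * (U j \<bullet> (Q *v V j)))"
    by (intro sum.cong refl) (simp add: inner_vec_def matrix_vector_mult_def sum_distrib_left)
  finally show ?thesis .
qed

text \<open>Cauchy-Schwarz over the index \<open>j\<close>, followed by Bessel's inequality in each
  of the two orthonormal families.\<close>

lemma diag_product_op_bound:
  assumes U: "orthonormal_columns r U" and V: "orthonormal_columns r V"
    and \<phi>: "\<And>j. j < r \<Longrightarrow> 0 \<le> \<phi> j \<and> \<phi> j \<le> c"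
    and c: "c > 0"
  shows "diag_product r U \<phi> V /\<^sub>R c \<in> op_unit_ball"
  unfolding op_unit_ball_def
proof (clarify)
  fix x y
  have "\<bar>x \<bullet> (diag_product r U \<phi> V *v y)\<bar> \<le> (\<Sum>j<r. \<bar>(x \<bullet> U j) * \<phi> j * (V j \<bullet> y)\<bar>)"
    unfolding inner_diag_product by (rule sum_abs)
  also have "\<dots> \<le> (\<Sum>j<r. c * (\<bar>x \<bullet> U j\<bar> * \<bar>y \<bullet> V j\<bar>))"
  proof (rule sum_mono)
    fix j assume "j \<in> {..<r}"
    then have "\<bar>\<phi> j\<bar> \<le> c" using \<phi>[of j] by auto
    from mult_right_mono[OF this, of "\<bar>x \<bullet> U j\<bar> * \<bar>y \<bullet> V j\<bar>"]
    show "\<bar>(x \<bullet> U j) * \<phi> j * (V j \<bullet> y)\<bar> \<le> c * (\<bar>x \<bullet> U j\<bar> * \<bar>y \<bullet> V j\<bar>)"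
      by (simp add: abs_mult mult_ac inner_commute)
  qed
  also have "\<dots> = c * (\<Sum>j<r. \<bar>x \<bullet> U j\<bar> * \<bar>y \<bullet> V j\<bar>)" by (simp add: sum_distrib_left)
  also have "\<dots> \<le> c * (L2_set (\<lambda>j. x \<bullet> U j) {..<r} * L2_set (\<lambda>j. y \<bullet> V j) {..<r})"
    using c by (intro mult_left_mono L2_set_mult_ineq) auto
  also have "\<dots> \<le> c * (norm x * norm y)"
    using c bessel_inequality[OF U, of x] bessel_inequality[OF V, of y]
    by (intro mult_left_mono mult_mono) (auto simp: L2_set_def real_le_lsqrt intro!: real_sqrt_ge_zero sum_nonneg)
  finally have "\<bar>x \<bullet> (diag_product r U \<phi> V *v y)\<bar> \<le> c * (norm x * norm y)" .
  then show "\<bar>x \<bullet> (diag_product r U \<phi> V /\<^sub>R c *v y)\<bar> \<le> norm x * norm y"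
    using c by (simp add: scaleR_matrix_vector_assoc[symmetric] abs_mult field_simps)
qed

lemma inner_diag_product_self:
  assumes U: "orthonormal_columns r U" and V: "orthonormal_columns r V"
  shows "diag_product r U \<phi> V \<bullet> diag_product r U s V = (\<Sum>j<r. \<phi> j * s j)"
proof -
  have "U j \<bullet> (diag_product r U \<phi> V *v V j) = \<phi> j" if j: "j < r" for j
  proof -
    have "U j \<bullet> (diag_product r U \<phi> V *v V j) = (\<Sum>i<r. if i = j then \<phi> j else 0)"
      unfolding inner_diag_product using U V j
      by (intro sum.cong) (auto simp: orthonormal_columns_def)
    then show ?thesis using j by simp
  qed
  then show ?thesis
    unfolding matrix_inner_diag_product by (intro sum.cong) auto
qed

text \<open>A test matrix from the ball evaluates to at most 1 on each pair of unit vectors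
  \<open>U j\<close>, \<open>V j\<close>, so the j-th term contributes at most
  \<open>s j\<close>.\<close>

lemma nuclear_norm_diag_product_le:
  assumes U: "orthonormal_columns r U" and V: "orthonormal_columns r V"
    and s: "\<And>j. j < r \<Longrightarrow> s j \<ge> 0"
  shows "nuclear_norm (diag_product r U s V) \<le> (\<Sum>j<r. s j)"
proof (rule nuclear_norm_le)
  fix Q :: "real ^ 'b ^ 'a" assume Q: "Q \<in> op_unit_ball"
  show "Q \<bullet> diag_product r U s V \<le> (\<Sum>j<r. s j)"
    unfolding matrix_inner_diag_product
  proof (rule sum_mono)
    fix j assume "j \<in> {..<r}"
    then have j: "j < r" by simp
    have "norm (U j) = 1" "norm (V j) = 1"
      using U V j by (auto simp: orthonormal_columns_def norm_eq_sqrt_inner)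
    then have "U j \<bullet> (Q *v V j) \<le> 1"
      using Q unfolding op_unit_ball_def by (metis (mono_tags, lifting) abs_le_D1 mem_Collect_eq mult_1)
    then show "s j * (U j \<bullet> (Q *v V j)) \<le> s j"
      using mult_left_mono[OF _ s[OF j], of "U j \<bullet> (Q *v V j)" 1] by simp
  qed
qed

lemma polar_op_bound:
  assumes "P \<in> polar \<delta> Z" "\<delta> \<ge> 0"
  shows "P /\<^sub>R (1 + \<delta>) \<in> op_unit_ball"
proof (cases "Z = 0")
  case True
  then show ?thesis using assms by (simp add: polar_def op_unit_ballI)
next
  case False
  then obtain U \<phi> V s where "P = diag_product (rank Z) U \<phi> V" "compact_svd Z U s V"
    and "\<forall>j<rank Z. 0 \<le> \<phi> j \<and> \<phi> j \<le> 1 + \<delta>"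
    using assms(1) by (auto simp: polar_def)
  then show ?thesis
    using assms(2) by (auto simp: compact_svd_def intro!: diag_product_op_bound)
qed

text \<open>Each singular value costs at most \<delta>: a large one loses at most
  \<open>\<delta> * s j\<close>, where \<open>s j \<le> 1\<close> because
  \<open>norm Z \<le> 1\<close>, and a small one is below \<delta> altogether. The rank, at most
  \<open>CARD('m)\<close>, counts the losses.\<close>

lemma polar_inner_ge:
  fixes Z :: "real ^ 'n ^ 'm"
  assumes P: "P \<in> polar \<delta> Z" and \<delta>: "0 \<le> \<delta>" and Z: "norm Z \<le> 1"
  shows "P \<bullet> Z \<ge> nuclear_norm Z - real CARD('m) * \<delta>"
proof (cases "Z = 0")
  case False
  then obtain U \<phi> V s where P_eq: "P = diag_product (rank Z) U \<phi> V" and svd: "compact_svd Z U s V"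
    and \<phi>: "\<And>j. j < rank Z \<Longrightarrow> 0 \<le> \<phi> j \<and> \<phi> j \<le> 1 + \<delta> \<and> (s j \<ge> \<delta> \<longrightarrow> \<phi> j \<ge> 1 - \<delta>)"
    using assms(1) by (auto simp: polar_def)
  let ?r = "rank Z"
  have U: "orthonormal_columns ?r U" and V: "orthonormal_columns ?r V"
    and s: "\<And>j. j < ?r \<Longrightarrow> s j > 0" and Z_eq: "Z = diag_product ?r U s V"
    using svd unfolding compact_svd_def by blast+
  have "(\<Sum>j<?r. (s j)\<^sup>2) = Z \<bullet> Z"
    using inner_diag_product_self[OF U V, of s s] Z_eq[symmetric] by (simp add: power2_eq_square)
  also have "\<dots> \<le> 1" using Z by (simp add: power2_norm_eq_inner[symmetric] power_le_one)
  finally have sum_le: "(\<Sum>j<?r. (s j)\<^sup>2) \<le> 1" .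
  have s_le: "s j \<le> 1" if "j < ?r" for j
  proof -
    have "(s j)\<^sup>2 \<le> (\<Sum>j<?r. (s j)\<^sup>2)" using that by (intro member_le_sum) auto
    then have "(s j)\<^sup>2 \<le> 1\<^sup>2" using sum_le by simp
    then show ?thesis by (rule power2_le_imp_le) simp
  qed
  have "nuclear_norm Z \<le> (\<Sum>j<?r. s j)"
    using nuclear_norm_diag_product_le[OF U V, of s] s Z_eq[symmetric] by (simp add: less_imp_le)
  also have "\<dots> \<le> (\<Sum>j<?r. \<phi> j * s j + \<delta>)"
  proof (rule sum_mono)
    fix j assume "j \<in> {..<?r}"
    then have j: "j < ?r" by simp
    show "s j \<le> \<phi> j * s j + \<delta>"
    proof (cases "s j \<ge> \<delta>")
      case True
      then have "(1 - \<delta>) * s j \<le> \<phi> j * s j"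
        using \<phi>[OF j] s[OF j] by (intro mult_right_mono) auto
      moreover have "\<delta> * s j \<le> \<delta>" using mult_left_mono[OF s_le[OF j] \<delta>] by simp
      ultimately show ?thesis by (simp add: algebra_simps)
    next
      case False
      then show ?thesis using \<phi>[OF j] s[OF j] by (simp add: add_increasing)
    qed
  qed
  also have "\<dots> = P \<bullet> Z + ?r * \<delta>"
    using inner_diag_product_self[OF U V, of \<phi> s] Z_eq[symmetric] P_eq by (simp add: sum.distrib)
  also have "\<dots> \<le> P \<bullet> Z + real CARD('m) * \<delta>"
    using rank_bound[of Z] \<delta> by (intro add_left_mono mult_right_mono) auto
  finally show ?thesis by simp
qed (use assms in \<open>simp add: polar_def\<close>)

lemma norm_normalized_le:
  assumes "\<sigma> \<ge> 0"
  shows "norm (normalized \<sigma> M) \<le> 1"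
proof (cases "norm M + \<sigma> = 0")
  case False
  then have "norm M + \<sigma> > 0" using assms by (simp add: add_nonneg_nonneg order_less_le)
  then show ?thesis using assms by (simp add: normalized_def divide_inverse[symmetric] mult.commute)
qed (use assms in \<open>simp add: normalized_def\<close>)

text \<open>Multiplying by \<open>norm M + \<sigma>\<close> undoes the normalization and scales only
  the error term, so a bounded \<sigma> is harmless once \<delta> tends to 0.\<close>

lemma polar_normalized_inner_ge:
  fixes M :: "real ^ 'n ^ 'm"
  assumes P: "P \<in> polar \<delta> (normalized \<sigma> M)" and \<delta>: "0 \<le> \<delta>" and \<sigma>: "\<sigma> \<ge> 0"
  shows "P \<bullet> M \<ge> nuclear_norm M - (norm M + \<sigma>) * (real CARD('m) * \<delta>)"
proof (cases "M = 0")
  case True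
  then show ?thesis using \<delta> \<sigma> by simp
next
  case False
  define c where "c = norm M + \<sigma>"
  have c: "c > 0" using False \<sigma> by (simp add: c_def add_pos_nonneg)
  have M: "M = c *\<^sub>R normalized \<sigma> M"
    using False c by (simp add: normalized_def c_def)
  have "nuclear_norm M \<le> c * nuclear_norm (normalized \<sigma> M)"
    using nuclear_norm_scale_le[of c "normalized \<sigma> M"] c M by simp
  also have "\<dots> \<le> c * (P \<bullet> normalized \<sigma> M + real CARD('m) * \<delta>)"
    using polar_inner_ge[OF P \<delta> norm_normalized_le[OF \<sigma>]] c by (intro mult_left_mono) auto
  also have "\<dots> = P \<bullet> M + c * (real CARD('m) * \<delta>)"
  proof -
    have "P \<bullet> M = c * (P \<bullet> normalized \<sigma> M)" by (metis M inner_scaleR_right)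
    then show ?thesis by (simp add: algebra_simps)
  qed
  finally show ?thesis by (simp add: c_def)
qed

text \<open>Combines near membership of \<open>P\<close> in the dual ball with near attainment at
  \<open>M\<close>. For bounded \<open>M\<close> and \<sigma> and fixed \<open>Y\<close> the error
  is of order \<delta>.\<close>

lemma polar_approx_subgradient:
  fixes M Y :: "real ^ 'n ^ 'm"
  assumes P: "P \<in> polar \<delta> (normalized \<sigma> M)" and \<delta>: "0 \<le> \<delta>" and \<sigma>: "\<sigma> \<ge> 0"
  shows "P \<bullet> (Y - M) \<le> nuclear_norm Y - nuclear_norm M
           + \<delta> * (nuclear_norm Y + (norm M + \<sigma>) * real CARD('m))"
proof -
  have "(P /\<^sub>R (1 + \<delta>)) \<bullet> Y \<le> nuclear_norm Y"
    by (intro inner_le_nuclear_norm polar_op_bound[OF P \<delta>])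
  then have "P \<bullet> Y \<le> (1 + \<delta>) * nuclear_norm Y"
    using \<delta> by (simp add: field_simps)
  with polar_normalized_inner_ge[OF P \<delta> \<sigma>] show ?thesis
    by (simp add: inner_diff_right algebra_simps)
qed

section \<open>Limit curves of slowly moving sequences\<close>

text \<open>With \<open>S\<close> as clock, \<open>i\<close> is the step during which time
  \<open>u\<close> occurs. The first inequality is minimality: the predecessor of \<open>i\<close>
  fails the defining test, and if there is none, \<open>S 0 \<le> u\<close> applies.\<close>

lemma LEAST_step_index:
  fixes S :: "nat \<Rightarrow> real"
  assumes "filterlim S at_top sequentially" "S 0 \<le> u"
  defines "i \<equiv> LEAST n. u < S (Suc n)"
  shows "S i \<le> u" "u < S (Suc i)"
proof -
  obtain n where "u < S n"
    using assms(1) by (metis eventually_at_top_dense eventually_sequentially filterlim_iff order_refl)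
  then have "u < S (Suc (n - 1))"
    using assms(2) by (cases n) auto
  then show "u < S (Suc i)"
    unfolding i_def by (rule LeastI)
  show "S i \<le> u"
  proof (cases i)
    case 0
    then show ?thesis using assms(2) by simp
  next
    case (Suc j)
    then have "\<not> u < S (Suc j)"
      using not_less_Least[of j "\<lambda>n. u < S (Suc n)"] by (simp add: i_def)
    then show ?thesis using Suc by simp
  qed
qed

lemma norm_diff_le_sum_steps:
  fixes z :: "nat \<Rightarrow> 'a::real_normed_vector"
  assumes "\<And>n. norm (z (Suc n) - z n) \<le> L * \<eta> n" "i \<le> j"
  shows "norm (z j - z i) \<le> L * sum \<eta> {i..<j}"
proof -
  have "norm (z j - z i) = norm (\<Sum>n=i..<j. z (Suc n) - z n)"
    using assms(2) by (simp add: sum_Suc_diff')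
  also have "\<dots> \<le> (\<Sum>n=i..<j. L * \<eta> n)"
    by (intro order_trans[OF norm_sum] sum_mono assms(1))
  finally show ?thesis by (simp add: sum_distrib_left)
qed

text \<open>
  \<open>Z\<close> is the limit of the step interpolations of \<open>z\<close> started at the indices \<open>p k\<close>; \<open>m k s\<close> is
  the index reached after the elapsed time \<open>T s\<close>. Scaling time by \<open>T\<close> puts every window on \<open>[0, 1]\<close>,
  the interval on which conservative fields are tested.
\<close>
locale limit_curve =
  fixes \<eta> :: "nat \<Rightarrow> real" and z :: "nat \<Rightarrow> 'a::euclidean_space" and L T :: real
    and p :: "nat \<Rightarrow> nat" and m :: "nat \<Rightarrow> real \<Rightarrow> nat" and Z :: "real \<Rightarrow> 'a"
  assumes eta_pos: "\<And>n. \<eta> n > 0"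
    and step: "\<And>n. norm (z (Suc n) - z n) \<le> L * \<eta> n"
    and T_pos: "T > 0"
    and start_tendsto: "filterlim p at_top sequentially"
    and index_start: "\<And>k. m k 0 = p k"
    and index_mono: "\<And>k s s'. 0 \<le> s \<Longrightarrow> s \<le> s' \<Longrightarrow> m k s \<le> m k s'"
    and elapsed_le: "\<And>k s. 0 \<le> s \<Longrightarrow> sum \<eta> {p k..<m k s} \<le> T * s"
    and elapsed_tendsto: "\<And>s. 0 \<le> s \<Longrightarrow> (\<lambda>k. sum \<eta> {p k..<m k s}) \<longlonglongrightarrow> T * s"
    and curve_tendsto: "\<And>s. s \<in> {0..1} \<Longrightarrow> (\<lambda>k. z (m k s)) \<longlonglongrightarrow> Z s"
    and curve_lipschitz: "(L * T)-lipschitz_on UNIV Z"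

text \<open>An Arzela-Ascoli argument for step functions. They are discontinuous, but increments are
  controlled by elapsed times, which converge to \<open>T * s\<close>; so convergence at rational
  times spreads to all times and the limit is Lipschitz.\<close>

lemma limit_curve_exists:
  fixes z :: "nat \<Rightarrow> 'a::euclidean_space" and t :: "nat \<Rightarrow> nat"
  assumes eta_pos: "\<And>n. \<eta> n > 0" and eta_lim: "\<eta> \<longlonglongrightarrow> 0"
    and eta_div: "filterlim (\<lambda>n. \<Sum>i<n. \<eta> i) at_top sequentially"
    and step: "\<And>n. norm (z (Suc n) - z n) \<le> L * \<eta> n"
    and bdd: "\<And>n. norm (z n) \<le> B"
    and T: "T > 0" and t: "strict_mono t"
  obtains r m Z where "strict_mono r" "limit_curve \<eta> z L T (t \<circ> r) m Z"
proof -
  define S where "S n = (\<Sum>i<n. \<eta> i)" for n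
  have S_lim: "filterlim S at_top sequentially" using eta_div by (simp add: S_def[abs_def])
  have S_diff: "sum \<eta> {i..<j} = S j - S i" if "i \<le> j" for i j
    using sum_diff_nat_ivl[of 0 i j \<eta>] that by (simp add: S_def lessThan_atLeast0)
  have S_strict: "strict_mono S"
    by (rule strict_mono_Suc_iff[THEN iffD2]) (simp add: S_def eta_pos)
  have L0: "L \<ge> 0"
    using order_trans[OF norm_ge_zero step[of 0]] eta_pos[of 0] by (simp add: zero_le_mult_iff)
  have S0: "S 0 \<le> S (t k) + T * s" if "0 \<le> s" for k s
    using that T S_strict by (auto simp: S_def intro!: add_nonneg_nonneg sum_nonneg less_imp_le[OF eta_pos])
  \<comment> \<open>The last index whose clock reading does not exceed that of \<open>t k\<close> by
    more than \<open>T * s\<close>.\<close>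
  define i where "i k s = (LEAST n. S (t k) + T * s < S (Suc n))" for k s
  have i_le: "S (i k s) \<le> S (t k) + T * s" and i_gt: "S (t k) + T * s < S (Suc (i k s))"
    if "0 \<le> s" for k s
    using LEAST_step_index[OF S_lim S0[OF that]] by (simp_all add: i_def)
  have i_mono: "i k s \<le> i k s'" if "0 \<le> s" "s \<le> s'" for k s s'
  proof -
    have "S (i k s) < S (Suc (i k s'))"
      using i_le[of s k] i_gt[of s' k] that mult_left_mono[of s s' T] T by linarith
    then show ?thesis using S_strict by (simp add: strict_mono_less less_Suc_eq_le)
  qed
  have i_0: "i k 0 = t k" for k
  proof -
    have "S (i k 0) \<le> S (t k)" "S (t k) < S (Suc (i k 0))"
      using i_le[of 0 k] i_gt[of 0 k] by simp_all
    then show ?thesis using S_strict by (simp add: strict_mono_less strict_mono_less_eq)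
  qed
  have i_ge: "t k \<le> i k s" if "0 \<le> s" for k s
    using i_mono[OF order_refl that, of k] i_0 by simp
  have t_ge: "k \<le> t k" for k :: nat using strict_mono_imp_increasing[OF t] .
  define e where "e k s = S (i k s) - S (t k)" for k s
  have e_le: "e k s \<le> T * s" if "0 \<le> s" for k s using i_le[OF that, of k] by (simp add: e_def)
  have e_lim: "(\<lambda>k. e k s) \<longlonglongrightarrow> T * s" if "0 \<le> s" for s
  proof -
    have "filterlim (\<lambda>k. i k s) at_top sequentially"
      by (rule filterlim_at_top_mono[OF filterlim_ident])
         (use i_ge[OF that] t_ge order_trans in \<open>fastforce intro!: always_eventually\<close>)
    then have "(\<lambda>k. \<eta> (i k s)) \<longlonglongrightarrow> 0"
      using eta_lim filterlim_compose by blast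
    \<comment> \<open>The elapsed time falls short of \<open>T * s\<close> by less than the step in
      progress, and that step size vanishes.\<close>
    then have *: "(\<lambda>k. T * s - \<eta> (i k s)) \<longlonglongrightarrow> T * s"
      using tendsto_diff[OF tendsto_const] by fastforce
    show ?thesis
    proof (rule tendsto_sandwich[OF _ _ * tendsto_const])
      show "\<forall>\<^sub>F k in sequentially. T * s - \<eta> (i k s) \<le> e k s"
        using i_gt[OF that] by (intro always_eventually) (auto simp: e_def S_def algebra_simps less_imp_le)
      show "\<forall>\<^sub>F k in sequentially. e k s \<le> T * s"
        using e_le[OF that] by simp
    qed
  qed
  have dist_le: "norm (z (i k s) - z (i k s')) \<le> L * \<bar>e k s - e k s'\<bar>" for k s s'
  proof (cases "i k s' \<le> i k s")
    case True
    then have "S (i k s') \<le> S (i k s)" using S_strict by (simp add: strict_mono_less_eq)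
    then show ?thesis
      using norm_diff_le_sum_steps[where z = z and L = L and \<eta> = \<eta>, OF step True] by (simp add: S_diff[OF True] e_def)
  next
    case False
    then have le: "i k s \<le> i k s'" by simp
    then have "S (i k s) \<le> S (i k s')" using S_strict by (simp add: strict_mono_less_eq)
    then show ?thesis
      using norm_diff_le_sum_steps[where z = z and L = L and \<eta> = \<eta>, OF step le] by (simp add: S_diff[OF le] e_def norm_minus_commute)
  qed
  \<comment> \<open>Diagonal extraction needs countably many times; the rationals of the interval
    include the endpoints.\<close>
  have "countable ({0..1::real} \<inter> \<rat>)" by (simp add: countable_rat)
  then obtain r where r: "strict_mono r"
    and conv: "\<And>q. q \<in> {0..1} \<inter> \<rat> \<Longrightarrow> \<exists>l. (\<lambda>k. z (i (r k) q)) \<longlonglongrightarrow> l"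
    using function_convergent_subsequence[of "{0..1} \<inter> \<rat>" "\<lambda>k s. z (i k s)" B] bdd by auto
  have e_lim_r: "(\<lambda>k. e (r k) s) \<longlonglongrightarrow> T * s" if "0 \<le> s" for s
    using LIMSEQ_subseq_LIMSEQ[OF e_lim[OF that] r] by (simp add: o_def)
  have conv_all: "convergent (\<lambda>k. z (i (r k) s))" if s: "s \<in> {0..1}" for s
  proof -
    have "Cauchy (\<lambda>k. z (i (r k) s))"
    proof (rule metric_CauchyI)
      fix \<epsilon> :: real assume "\<epsilon> > 0"
      \<comment> \<open>A limit curve moves less than a quarter of \<epsilon> during
        \<open>d\<close>; the summand 1 covers \<open>L = 0\<close>.\<close>
      define d where "d = \<epsilon> / (4 * (L * T + 1))"
      have "L * T \<ge> 0" using L0 T by simp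
      then have d: "d > 0" "L * (T * d) < \<epsilon> / 4"
        using \<open>\<epsilon> > 0\<close> by (auto simp: d_def divide_simps algebra_simps)
      obtain q where q: "q \<in> {0..1} \<inter> \<rat>" "\<bar>s - q\<bar> \<le> d"
      proof (cases "s < 1")
        case True
        obtain q where "q \<in> \<rat>" "s < q" "q < min 1 (s + d)"
          using Rats_dense_in_real[of s "min 1 (s + d)"] True d by auto
        then show ?thesis using that[of q] s by auto
      next
        case False
        then show ?thesis using that[of 1] s d by auto
      qed
      then have q0: "0 \<le> q" by simp
      obtain l where l: "(\<lambda>k. z (i (r k) q)) \<longlonglongrightarrow> l" using conv q by blast
      have "(\<lambda>k. L * \<bar>e (r k) s - e (r k) q\<bar>) \<longlonglongrightarrow> L * \<bar>T * s - T * q\<bar>"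
        using s q0 by (intro tendsto_intros e_lim_r) auto
      moreover have "L * \<bar>T * s - T * q\<bar> < \<epsilon> / 4"
      proof -
        have "L * \<bar>T * s - T * q\<bar> = L * (T * \<bar>s - q\<bar>)"
          using T by (simp add: abs_mult right_diff_distrib[symmetric])
        also have "\<dots> \<le> L * (T * d)" using q(2) L0 T by (intro mult_left_mono) auto
        finally show ?thesis using d by simp
      qed
      ultimately have ev1: "\<forall>\<^sub>F k in sequentially. L * \<bar>e (r k) s - e (r k) q\<bar> < \<epsilon> / 4"
        by (rule order_tendstoD)
      have ev2: "\<forall>\<^sub>F k in sequentially. dist (z (i (r k) q)) l < \<epsilon> / 4"
        using tendstoD[OF l, of "\<epsilon> / 4"] \<open>\<epsilon> > 0\<close> by simp
      have "\<forall>\<^sub>F k in sequentially. dist (z (i (r k) s)) l < \<epsilon> / 2"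
        using ev1 ev2
      proof eventually_elim
        case (elim k)
        have "dist (z (i (r k) s)) (z (i (r k) q)) < \<epsilon> / 4"
          using dist_le[of "r k" s q] elim by (simp add: dist_norm)
        then show ?case
          using elim dist_triangle[of "z (i (r k) s)" l "z (i (r k) q)"] by simp
      qed
      then obtain K where K: "\<And>k. k \<ge> K \<Longrightarrow> dist (z (i (r k) s)) l < \<epsilon> / 2"
        by (auto simp: eventually_sequentially)
      show "\<exists>M. \<forall>k\<ge>M. \<forall>n\<ge>M. dist (z (i (r k) s)) (z (i (r n) s)) < \<epsilon>"
        using K dist_triangle_half_l by blast
    qed
    then show ?thesis by (simp add: Cauchy_convergent)
  qed
  \<comment> \<open>Clamping the time extends the curve constantly beyond the unit interval, so that
    it is Lipschitz on the whole line as the differentiation results require.\<close>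
  define Z where "Z s = lim (\<lambda>k. z (i (r k) (max 0 (min 1 s))))" for s
  have Z_lim: "(\<lambda>k. z (i (r k) (max 0 (min 1 s)))) \<longlonglongrightarrow> Z s" for s
    unfolding Z_def using conv_all[of "max 0 (min 1 s)"] by (simp add: convergent_LIMSEQ_iff)
  have "limit_curve \<eta> z L T (t \<circ> r) (\<lambda>k. i (r k)) Z"
  proof
    show "filterlim (t \<circ> r) at_top sequentially"
      using filterlim_subseq[OF strict_mono_o[OF t r]] .
    show "i (r k) 0 = (t \<circ> r) k" for k using i_0 by simp
    show "i (r k) s \<le> i (r k) s'" if "0 \<le> s" "s \<le> s'" for k s s' using i_mono that .
    show "sum \<eta> {(t \<circ> r) k..<i (r k) s} \<le> T * s" if "0 \<le> s" for k s
      using e_le[OF that, of "r k"] S_diff[OF i_ge[OF that], of "r k"] by (simp add: e_def)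
    show "(\<lambda>k. sum \<eta> {(t \<circ> r) k..<i (r k) s}) \<longlonglongrightarrow> T * s" if "0 \<le> s" for s
      using e_lim_r[OF that] S_diff[OF i_ge[OF that]] by (simp add: e_def)
    show "(\<lambda>k. z (i (r k) s)) \<longlonglongrightarrow> Z s" if "s \<in> {0..1}" for s
      using Z_lim[of s] that by simp
    show "(L * T)-lipschitz_on UNIV Z"
    proof (rule lipschitz_onI)
      fix s s' :: real
      let ?c = "\<lambda>s::real. max 0 (min 1 s)"
      have "norm (Z s - Z s') \<le> L * \<bar>T * ?c s - T * ?c s'\<bar>"
      proof (rule tendsto_le[OF sequentially_bot])
        show "(\<lambda>k. norm (z (i (r k) (?c s)) - z (i (r k) (?c s')))) \<longlonglongrightarrow> norm (Z s - Z s')"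
          by (intro tendsto_intros Z_lim)
        show "(\<lambda>k. L * \<bar>e (r k) (?c s) - e (r k) (?c s')\<bar>) \<longlonglongrightarrow> L * \<bar>T * ?c s - T * ?c s'\<bar>"
          by (intro tendsto_intros e_lim_r) auto
        show "\<forall>\<^sub>F k in sequentially. norm (z (i (r k) (?c s)) - z (i (r k) (?c s')))
            \<le> L * \<bar>e (r k) (?c s) - e (r k) (?c s')\<bar>"
          using dist_le by simp
      qed
      also have "\<dots> = L * T * \<bar>?c s - ?c s'\<bar>"
        using T by (simp add: abs_mult right_diff_distrib[symmetric])
      also have "\<dots> \<le> L * T * \<bar>s - s'\<bar>"
        using L0 T by (intro mult_left_mono) auto
      finally show "dist (Z s) (Z s') \<le> L * T * dist s s'" by (simp add: dist_norm)
    qed (use L0 T in auto)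
  qed (use eta_pos step T in auto)
  then show thesis using that r by blast
qed

context limit_curve
begin

lemma step_const_nonneg: "L \<ge> 0"
  using order_trans[OF norm_ge_zero step[of 0]] eta_pos[of 0] by (simp add: zero_le_mult_iff)

lemma index_ge_start: "0 \<le> s \<Longrightarrow> p k \<le> m k s"
  using index_mono[of 0 s k] index_start by simp

lemma index_tendsto: "0 \<le> s \<Longrightarrow> filterlim (\<lambda>k. m k s) at_top sequentially"
  by (rule filterlim_at_top_mono[OF start_tendsto]) (simp add: index_ge_start)

lemma elapsed_between:
  assumes "0 \<le> s" "s \<le> s'"
  shows "(\<lambda>k. sum \<eta> {m k s..<m k s'}) \<longlonglongrightarrow> T * (s' - s)"
proof -
  have "sum \<eta> {p k..<m k s} + sum \<eta> {m k s..<m k s'} = sum \<eta> {p k..<m k s'}" for k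
    using assms index_ge_start index_mono by (intro sum.atLeastLessThan_concat) auto
  then have "(\<lambda>k. sum \<eta> {m k s..<m k s'}) = (\<lambda>k. sum \<eta> {p k..<m k s'} - sum \<eta> {p k..<m k s})"
    by (simp add: fun_eq_iff eq_diff_eq add.commute)
  moreover have "(\<lambda>k. sum \<eta> {p k..<m k s'} - sum \<eta> {p k..<m k s}) \<longlonglongrightarrow> T * s' - T * s"
    using assms by (intro tendsto_diff elapsed_tendsto) auto
  ultimately show ?thesis by (simp add: right_diff_distrib)
qed

text \<open>If late steps taken near \<open>Z s\<close> advance along \<open>u\<close> at rate at
  most \<open>c\<close> up to \<epsilon>, summing them over the window from \<open>s\<close> to
  \<open>s + h\<close> and letting first \<open>k\<close> grow, then \<open>h\<close> shrink, bounds
  the derivative. The factor \<open>T\<close> is the time scaling.\<close>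

lemma derivative_halfspace:
  assumes s: "0 < s" "s < 1" and deriv: "(Z has_vector_derivative d) (at s)"
    and near: "\<And>\<epsilon>. \<epsilon> > 0 \<Longrightarrow> \<exists>\<rho>>0. \<exists>n0. \<forall>n\<ge>n0. dist (z n) (Z s) < \<rho> \<longrightarrow>
      u \<bullet> (z (Suc n) - z n) \<le> \<eta> n * (c + \<epsilon>)"
  shows "u \<bullet> d \<le> T * c"
proof -
  have bound: "u \<bullet> d \<le> T * (c + \<epsilon>)" if "\<epsilon> > 0" for \<epsilon>
  proof -
    obtain \<rho> n0 where \<rho>: "\<rho> > 0" and n0: "\<And>n. n \<ge> n0 \<Longrightarrow> dist (z n) (Z s) < \<rho> \<Longrightarrow>
      u \<bullet> (z (Suc n) - z n) \<le> \<eta> n * (c + \<epsilon>)"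
      using near[OF \<open>\<epsilon> > 0\<close>] by metis
    \<comment> \<open>The first bound keeps the window inside the unit interval. The second keeps
      the drift over the window below \<rho>/2, so that iterates starting within \<rho>/2 of
      \<open>Z s\<close> stay within \<rho>.\<close>
    define h0 where "h0 = min (1 - s) (\<rho> / (4 * (L * T + 1)))"
    have LT: "L * T \<ge> 0" using step_const_nonneg T_pos by simp
    have h0: "h0 > 0" using \<rho> LT s by (simp add: h0_def add_nonneg_pos)
    have key: "u \<bullet> (Z (s + h) - Z s) \<le> T * h * (c + \<epsilon>)" if h: "0 < h" "h < h0" for h
    proof -
      have sh: "s + h \<le> 1" "0 \<le> s + h" using h s by (auto simp: h0_def)
      have "L * (T * h) < \<rho> / 2"
      proof -
        have "L * T * h \<le> (L * T + 1) * h" using h by simp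
        also have "\<dots> < (L * T + 1) * (\<rho> / (2 * (L * T + 1)))"
          using h LT \<rho> by (intro mult_strict_left_mono) (auto simp: h0_def field_simps)
        also have "\<dots> = \<rho> / 2" using LT by (simp add: field_simps)
        finally show ?thesis by (simp add: mult.assoc)
      qed
      moreover have "(\<lambda>k. L * sum \<eta> {m k s..<m k (s + h)}) \<longlonglongrightarrow> L * (T * h)"
        using elapsed_between[of s "s + h"] s h by (intro tendsto_mult_left) simp
      ultimately have ev1: "\<forall>\<^sub>F k in sequentially. L * sum \<eta> {m k s..<m k (s + h)} < \<rho> / 2"
        by (metis order_tendstoD(2))
      have ev2: "\<forall>\<^sub>F k in sequentially. dist (z (m k s)) (Z s) < \<rho> / 2"
        using tendstoD[OF curve_tendsto[of s], of "\<rho> / 2"] \<rho> s by simp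
      have ev3: "\<forall>\<^sub>F k in sequentially. n0 \<le> m k s"
        using index_tendsto[of s] s by (simp add: filterlim_at_top)
      have "\<forall>\<^sub>F k in sequentially.
          u \<bullet> (z (m k (s + h)) - z (m k s)) \<le> sum \<eta> {m k s..<m k (s + h)} * (c + \<epsilon>)"
        using ev1 ev2 ev3
      proof eventually_elim
        case (elim k)
        have le: "m k s \<le> m k (s + h)" using index_mono s h by simp
        have "u \<bullet> (z (m k (s + h)) - z (m k s)) = (\<Sum>n=m k s..<m k (s + h). u \<bullet> (z (Suc n) - z n))"
          using sum_Suc_diff'[OF le, of z] by (simp add: inner_sum_right[symmetric])
        also have "\<dots> \<le> (\<Sum>n=m k s..<m k (s + h). \<eta> n * (c + \<epsilon>))"
        proof (rule sum_mono)
          fix n assume n: "n \<in> {m k s..<m k (s + h)}"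
          then have "norm (z n - z (m k s)) \<le> L * sum \<eta> {m k s..<n}"
            by (intro norm_diff_le_sum_steps[where \<eta> = \<eta>] step) auto
          also have "\<dots> \<le> L * sum \<eta> {m k s..<m k (s + h)}"
            using n step_const_nonneg eta_pos
            by (intro mult_left_mono sum_mono2) (auto simp: less_imp_le)
          finally have "dist (z n) (Z s) < \<rho>"
            using elim dist_triangle[of "z n" "Z s" "z (m k s)"] by (simp add: dist_norm)
          then show "u \<bullet> (z (Suc n) - z n) \<le> \<eta> n * (c + \<epsilon>)"
            using n0 n elim by auto
        qed
        finally show ?case by (simp add: sum_distrib_right)
      qed
      moreover have "(\<lambda>k. u \<bullet> (z (m k (s + h)) - z (m k s))) \<longlonglongrightarrow> u \<bullet> (Z (s + h) - Z s)"
        using s sh by (intro tendsto_intros curve_tendsto) auto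
      moreover have "(\<lambda>k. sum \<eta> {m k s..<m k (s + h)} * (c + \<epsilon>)) \<longlonglongrightarrow> T * h * (c + \<epsilon>)"
        using elapsed_between[of s "s + h"] s h by (intro tendsto_mult_right) simp
      ultimately show ?thesis using tendsto_le sequentially_bot by blast
    qed
    have "((\<lambda>y. u \<bullet> Z y) has_real_derivative u \<bullet> d) (at s)"
      using bounded_linear.has_vector_derivative[OF bounded_linear_inner_right deriv]
      by (simp add: has_real_derivative_iff_has_vector_derivative)
    \<comment> \<open>Windows run forward in time, so only right-hand quotients are controlled; the
      derivative is assumed to exist, so these determine it.\<close>
    then have "((\<lambda>y. (u \<bullet> Z y - u \<bullet> Z s) / (y - s)) \<longlongrightarrow> u \<bullet> d) (at_right s)"
      unfolding has_field_derivative_iff by (rule tendsto_mono[rotated]) (simp add: at_le)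
    moreover have "\<forall>\<^sub>F y in at_right s. (u \<bullet> Z y - u \<bullet> Z s) / (y - s) \<le> T * (c + \<epsilon>)"
      unfolding eventually_at_right_field
    proof (intro exI[of _ "s + h0"] conjI allI impI)
      fix y assume "s < y" "y < s + h0"
      then have "u \<bullet> (Z y - Z s) \<le> T * (y - s) * (c + \<epsilon>)"
        using key[of "y - s"] by simp
      then show "(u \<bullet> Z y - u \<bullet> Z s) / (y - s) \<le> T * (c + \<epsilon>)"
        using \<open>s < y\<close> by (simp add: divide_le_eq inner_diff_right mult_ac)
    qed (use h0 in simp)
    ultimately show ?thesis
      by (rule tendsto_upperbound) simp
  qed
  show ?thesis
  proof (rule field_le_epsilon)
    fix e :: real assume "e > 0"
    then show "u \<bullet> d \<le> T * c + e"
      using bound[of "e / T"] T_pos by (simp add: distrib_left)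
  qed
qed

end

section \<open>Convergence from a strict Lyapunov function\<close>

text \<open>Here \<open>C\<close> is the set of critical states. Once the values converge, \<Phi> is
  constant along every limit curve, so by \<open>descent\<close> a limit curve can start only in
  \<open>C\<close>; every cluster point is such a start.\<close>

lemma lyapunov_convergence:
  fixes z :: "nat \<Rightarrow> 'a::euclidean_space" and \<Phi> :: "'a \<Rightarrow> real"
  assumes eta_pos: "\<And>n. \<eta> n > 0" and eta_lim: "\<eta> \<longlonglongrightarrow> 0"
    and eta_div: "filterlim (\<lambda>n. \<Sum>i<n. \<eta> i) at_top sequentially"
    and step: "\<And>n. norm (z (Suc n) - z n) \<le> L * \<eta> n"
    and bdd: "\<And>n. norm (z n) \<le> B"
    and cont: "continuous_on UNIV \<Phi>"
    and sard: "interior (\<Phi> ` C) = {}"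
    and descent: "\<And>T p m Z. limit_curve \<eta> z L T p m Z \<Longrightarrow> Z 0 \<notin> C \<Longrightarrow> \<Phi> (Z 1) < \<Phi> (Z 0)"
  shows "convergent (\<lambda>n. \<Phi> (z n))"
    and "\<And>r x. strict_mono r \<Longrightarrow> (z \<circ> r) \<longlonglongrightarrow> x \<Longrightarrow> x \<in> C"
proof -
  have Phi_tendsto: "(\<lambda>k. \<Phi> (f k)) \<longlonglongrightarrow> \<Phi> x" if "f \<longlonglongrightarrow> x" for f :: "nat \<Rightarrow> 'a" and x
    using continuous_on_tendsto_compose[OF cont that] by simp
  have L0: "L \<ge> 0"
    using order_trans[OF norm_ge_zero step[of 0]] eta_pos[of 0] by (simp add: zero_le_mult_iff)
  have "compact (\<Phi> ` cball 0 B)"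
    by (intro compact_continuous_image continuous_on_subset[OF cont]) auto
  then have "bounded (\<Phi> ` cball 0 B)" by (rule compact_imp_bounded)
  then obtain b where b: "\<And>n. \<bar>\<Phi> (z n)\<bar> \<le> b"
    using bdd unfolding bounded_iff by (metis imageI mem_cball_0 real_norm_def)
  have uc: "uniformly_continuous_on (cball 0 B) \<Phi>"
    by (intro compact_uniformly_continuous continuous_on_subset[OF cont]) auto
  define a where "a = liminf (\<lambda>n. ereal (\<Phi> (z n)))"
  define a' where "a' = limsup (\<lambda>n. ereal (\<Phi> (z n)))"
  have no_gap: "\<not> a < a'"
  proof
    assume "a < a'"
    then obtain c0 where c0: "a < ereal c0" "ereal c0 < a'"
      using ereal_dense2 by blast
    then obtain d where d: "c0 < d" "ereal d < a'"
      using ereal_dense2[OF c0(2)] by auto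
    \<comment> \<open>An open interval cannot lie in a set with empty interior, so some level
      \<open>c\<close> in it is not critical; \<open>d\<close> leaves a gap above \<open>c\<close>
      still below the upper limit.\<close>
    have "\<not> {c0<..<d} \<subseteq> \<Phi> ` C"
      using interior_maximal[of "{c0<..<d}" "\<Phi> ` C"] sard d by auto
    then obtain c where c: "c0 < c" "c < d" "c \<notin> \<Phi> ` C" unfolding subset_iff by (metis greaterThanLessThan_iff)
    have ac: "a < ereal c" using c0 c by (metis less_ereal.simps(1) less_trans)
    have low: "\<exists>n\<ge>N. \<Phi> (z n) < c" for N
    proof (rule ccontr)
      assume "\<not> ?thesis"
      then have "\<forall>\<^sub>F n in sequentially. ereal c \<le> ereal (\<Phi> (z n))"
        by (auto simp: eventually_sequentially not_less)
      then have "ereal c \<le> a" unfolding a_def by (rule Liminf_bounded)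
      then show False using ac by simp
    qed
    have high: "\<exists>n\<ge>N. \<Phi> (z n) > d" for N
    proof (rule ccontr)
      assume "\<not> ?thesis"
      then have "\<forall>\<^sub>F n in sequentially. ereal (\<Phi> (z n)) \<le> ereal d"
        by (auto simp: eventually_sequentially not_less)
      then have "a' \<le> ereal d" unfolding a'_def by (rule Limsup_bounded)
      then show False using d(2) by simp
    qed
    \<comment> \<open>The last visits to \<open>\<Phi> \<le> c\<close> before an excursion above
      \<open>d\<close>.\<close>
    define Up where "Up = {t. \<exists>q>t. \<Phi> (z t) \<le> c \<and> (\<forall>j\<in>{t<..q}. \<Phi> (z j) > c) \<and> \<Phi> (z q) > d}"
    have "\<exists>t\<ge>N. t \<in> Up" for N
    proof -
      obtain n where n: "n \<ge> N" "\<Phi> (z n) < c" using low by blast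
      obtain q where q: "q \<ge> n" "\<Phi> (z q) > d" using high by blast
      define A where "A = {t \<in> {n..q}. \<Phi> (z t) \<le> c}"
      have A: "finite A" "n \<in> A" using n q by (auto simp: A_def)
      then have M: "Max A \<in> A" by (intro Max_in) auto
      have "\<Phi> (z j) > c" if "j \<in> {Max A<..q}" for j
      proof (rule ccontr)
        assume "\<not> \<Phi> (z j) > c"
        then have "j \<in> A" using that M by (auto simp: A_def)
        then show False using Max_ge[OF A(1)] that by fastforce
      qed
      moreover have Mq: "n \<le> Max A" "Max A \<le> q" "\<Phi> (z (Max A)) \<le> c"
        using M by (simp_all add: A_def)
      moreover have "Max A \<noteq> q" using Mq(3) q c by auto
      ultimately show ?thesis
        unfolding Up_def mem_Collect_eq
        using q n by (intro exI[of _ "Max A"] exI[of _ q] conjI ballI) auto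
    qed
    then have "infinite Up" by (auto simp: infinite_nat_iff_unbounded_le)
    then have t0_mono: "strict_mono (enumerate Up)" and t0_in: "enumerate Up N \<in> Up" for N
      by (simp_all add: strict_mono_enumerate enumerate_in_set)
    define t0 where "t0 = enumerate Up"
    have "\<forall>N. \<exists>q>t0 N. \<Phi> (z (t0 N)) \<le> c \<and> (\<forall>j\<in>{t0 N<..q}. \<Phi> (z j) > c) \<and> \<Phi> (z q) > d"
      using t0_in by (simp add: t0_def Up_def)
    then obtain q0 where tq: "\<And>N. q0 N > t0 N" "\<And>N. \<Phi> (z (t0 N)) \<le> c"
      "\<And>N j. j \<in> {t0 N<..q0 N} \<Longrightarrow> \<Phi> (z j) > c" "\<And>N. \<Phi> (z (q0 N)) > d"
      by metis
    obtain \<rho> where \<rho>: "\<rho> > 0" "\<And>x y. x \<in> cball 0 B \<Longrightarrow> y \<in> cball 0 B \<Longrightarrow> dist x y < \<rho> \<Longrightarrow>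
        dist (\<Phi> x) (\<Phi> y) < d - c"
      using uc[unfolded uniformly_continuous_on_def, rule_format, of "d - c"] c by (metis diff_gt_0_iff_gt)
    \<comment> \<open>So short that \<Phi> cannot climb from \<open>c\<close> to \<open>d\<close>
      within a window. Every window thus ends during its excursion, where \<Phi> is still above
      \<open>c\<close>.\<close>
    define T where "T = \<rho> / (L + 1)"
    have T: "T > 0" "L * T < \<rho>" using \<rho> L0 by (auto simp: T_def field_simps)
    obtain r m Z where r: "strict_mono r" and "limit_curve \<eta> z L T (t0 \<circ> r) m Z"
      using limit_curve_exists[OF eta_pos eta_lim eta_div step bdd T(1) t0_mono[folded t0_def]] .
    then interpret lc: limit_curve \<eta> z L T "t0 \<circ> r" m Z by simp
    define N where "N k = r k" for k
    have start: "m k 0 = t0 (N k)" for k using lc.index_start[of k] by (simp add: N_def)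
    have Z0: "(\<lambda>k. z (t0 (N k))) \<longlonglongrightarrow> Z 0" using lc.curve_tendsto[of 0] by (simp add: start)
    have Z1: "(\<lambda>k. z (m k 1)) \<longlonglongrightarrow> Z 1" using lc.curve_tendsto[of 1] by simp
    have close: "\<Phi> (z j) < d" if "j \<in> {t0 (N k)..m k 1}" for j k
    proof -
      have "norm (z j - z (t0 (N k))) \<le> L * sum \<eta> {t0 (N k)..<j}"
        using that by (intro norm_diff_le_sum_steps[where \<eta> = \<eta>] step) auto
      also have "\<dots> \<le> L * sum \<eta> {t0 (N k)..<m k 1}"
        using that L0 eta_pos by (intro mult_left_mono sum_mono2) (auto simp: less_imp_le)
      also have "\<dots> \<le> L * T"
        using lc.elapsed_le[of 1 k] L0 by (intro mult_left_mono) (auto simp: N_def)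
      finally have "dist (z j) (z (t0 (N k))) < \<rho>" using T by (simp add: dist_norm)
      then have "dist (\<Phi> (z j)) (\<Phi> (z (t0 (N k)))) < d - c" using \<rho>(2) bdd by simp
      then show ?thesis using tq(2)[of "N k"] by (simp add: dist_real_def)
    qed
    have above: "\<Phi> (z j) > c" if "j \<in> {t0 (N k)<..m k 1}" for j k
    proof -
      have "q0 (N k) \<notin> {t0 (N k)..m k 1}" using close[of "q0 (N k)" k] tq(4)[of "N k"] by force
      then have "m k 1 < q0 (N k)" using tq(1)[of "N k"] by force
      then show ?thesis using tq(3)[of j "N k"] that by auto
    qed
    have "\<Phi> (Z 0) = c"
    proof (rule antisym)
      show "\<Phi> (Z 0) \<le> c"
        using Phi_tendsto[OF Z0] tq(2) by (intro LIMSEQ_le_const2) auto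
      \<comment> \<open>The next iterates lie above \<open>c\<close> and have the same limit, since
        steps vanish; this pins \<open>\<Phi> (Z 0)\<close> to the level \<open>c\<close>
        itself.\<close>
      have "(\<lambda>k. z (Suc (t0 (N k)))) \<longlonglongrightarrow> Z 0"
      proof -
        have "filterlim (\<lambda>k. t0 (N k)) at_top sequentially"
          using lc.start_tendsto by (simp add: o_def N_def)
        then have lim: "(\<lambda>k. L * \<eta> (t0 (N k))) \<longlonglongrightarrow> L * 0"
          by (intro tendsto_mult_left filterlim_compose[OF eta_lim])
        have "(\<lambda>k. z (Suc (t0 (N k))) - z (t0 (N k))) \<longlonglongrightarrow> 0"
        proof (rule Lim_null_comparison)
          show "\<forall>\<^sub>F k in sequentially. norm (z (Suc (t0 (N k))) - z (t0 (N k))) \<le> L * \<eta> (t0 (N k))"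
            by (intro always_eventually allI step)
        qed (use lim in simp)
        from tendsto_add[OF this Z0] show ?thesis by simp
      qed
      from Phi_tendsto[OF this] show "c \<le> \<Phi> (Z 0)"
        using tq(3)[of "Suc (t0 N)" N for N] tq(1)
        by (intro LIMSEQ_le_const) (auto intro!: exI[of _ 0] less_imp_le simp: Suc_le_eq)
    qed
    then have lt: "\<Phi> (Z 1) < \<Phi> (Z 0)" using c(3) by (intro descent[OF lc.limit_curve_axioms]) auto
    have "\<forall>\<^sub>F k in sequentially. \<Phi> (z (m k 1)) < \<Phi> (z (t0 (N k)))"
      using order_tendstoD(2)[OF tendsto_diff[OF Phi_tendsto[OF Z1] Phi_tendsto[OF Z0]], of 0] lt by simp
    moreover have "\<forall>\<^sub>F k in sequentially. \<Phi> (z (m k 1)) < c"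
      using order_tendstoD(2)[OF Phi_tendsto[OF Z1]] lt \<open>\<Phi> (Z 0) = c\<close> by simp
    ultimately have "\<forall>\<^sub>F k in sequentially. False"
    proof eventually_elim
      case (elim k)
      have "t0 (N k) \<le> m k 1" using lc.index_ge_start[of 1 k] by (simp add: N_def)
      \<comment> \<open>\<open>above\<close> covers only indices strictly after the start; the
        strict drop rules out an empty window.\<close>
      moreover have "t0 (N k) \<noteq> m k 1" using elim(1) by auto
      ultimately show False using above[of "m k 1" k] elim by auto
    qed
    then show False by simp
  qed
  show conv: "convergent (\<lambda>n. \<Phi> (z n))"
  proof -
    have "a \<le> a'" unfolding a_def a'_def by (intro Liminf_le_Limsup) simp
    then have eq: "a = a'" using no_gap by simp
    have "ereal (- b) \<le> a"
      unfolding a_def using b by (intro Liminf_bounded always_eventually) (auto simp: abs_le_iff minus_le_iff)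
    moreover have "a' \<le> ereal b"
      unfolding a'_def using b by (intro Limsup_bounded always_eventually) (auto simp: abs_le_iff)
    ultimately obtain l where "a = ereal l" using eq by (cases a) auto
    then have "(\<lambda>n. ereal (\<Phi> (z n))) \<longlonglongrightarrow> ereal l"
      using eq unfolding a_def a'_def by (simp only: tendsto_iff_Liminf_eq_Limsup[OF sequentially_bot])
    then show ?thesis unfolding convergent_def by auto
  qed
  show "x \<in> C" if r: "strict_mono r" "(z \<circ> r) \<longlonglongrightarrow> x" for r x
  proof (rule ccontr)
    assume x: "x \<notin> C"
    obtain l where l: "(\<lambda>n. \<Phi> (z n)) \<longlonglongrightarrow> l" using conv by (auto simp: convergent_def)
    obtain r' m Z where r': "strict_mono r'" and "limit_curve \<eta> z L 1 (r \<circ> r') m Z"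
      using limit_curve_exists[OF eta_pos eta_lim eta_div step bdd zero_less_one r(1)] .
    then interpret lc: limit_curve \<eta> z L 1 "r \<circ> r'" m Z by simp
    have "(\<lambda>k. z (r (r' k))) \<longlonglongrightarrow> Z 0" using lc.curve_tendsto[of 0] lc.index_start by simp
    moreover have "(\<lambda>k. z (r (r' k))) \<longlonglongrightarrow> x" using LIMSEQ_subseq_LIMSEQ[OF r(2) r'] by (simp add: o_def)
    ultimately have "Z 0 = x" using LIMSEQ_unique by blast
    then have "\<Phi> (Z 1) < \<Phi> (Z 0)" using descent[OF lc.limit_curve_axioms] x by simp
    moreover have "\<Phi> (Z s) = l" if s: "s \<in> {0..1}" for s
    proof (rule LIMSEQ_unique)
      show "(\<lambda>k. \<Phi> (z (m k s))) \<longlonglongrightarrow> \<Phi> (Z s)" using Phi_tendsto[OF lc.curve_tendsto[OF s]] .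
      show "(\<lambda>k. \<Phi> (z (m k s))) \<longlonglongrightarrow> l"
        using filterlim_compose[OF l lc.index_tendsto[of s]] s by simp
    qed
    ultimately show False by auto
  qed
qed

section \<open>Conservative fields and the Muon recursion\<close>

text \<open>Measurability is assumed for \<open>k\<close> alone; completeness of Lebesgue measure
  passes it on to \<open>X\<close>. In the application \<open>X\<close> involves
  \<open>vector_derivative\<close>, uncontrolled on the null set.\<close>

lemma integral_lebesgue_on_negligible_cong:
  fixes X k :: "'a::euclidean_space \<Rightarrow> 'b::euclidean_space"
  assumes S: "S \<in> sets lebesgue" and N: "negligible N"
    and eq: "\<And>x. x \<in> S \<Longrightarrow> x \<notin> N \<Longrightarrow> X x = k x"
    and k: "k \<in> borel_measurable (lebesgue_on S)"
  shows "integral\<^sup>L (lebesgue_on S) X = integral\<^sup>L (lebesgue_on S) k"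
proof -
  have k': "(\<lambda>x. indicat_real S x *\<^sub>R k x) \<in> borel_measurable lebesgue"
    using k S by (simp add: borel_measurable_restrict_space_iff)
  have AE: "AE x in lebesgue. indicat_real S x *\<^sub>R k x = indicat_real S x *\<^sub>R X x"
    using N eq by (intro AE_I'[of N]) (force simp: negligible_iff_null_sets indicator_def)+
  have "integral\<^sup>L lebesgue (\<lambda>x. indicat_real S x *\<^sub>R k x) = integral\<^sup>L lebesgue (\<lambda>x. indicat_real S x *\<^sub>R X x)"
    by (rule integral_cong_AE[OF k' borel_measurable_AE[OF k' AE] AE])
  then show ?thesis
    using S by (simp add: integral_restrict_space)
qed

lemma lipschitz_imp_absolutely_continuous_on:
  assumes "C-lipschitz_on S \<gamma>"
  shows "absolutely_continuous_on S \<gamma>"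
  unfolding absolutely_continuous_on_def
proof (intro allI impI)
  fix \<epsilon> :: real assume \<epsilon>: "\<epsilon> > 0"
  have C: "C \<ge> 0" using assms lipschitz_on_nonneg by blast
  have bound: "(\<Sum>i<N. dist (\<gamma> (a i)) (\<gamma> (b i))) < \<epsilon>"
    if ab: "\<forall>i<N. a i \<le> b i \<and> a i \<in> S \<and> b i \<in> S" and sum: "(\<Sum>i<N. b i - a i) < \<epsilon> / (C + 1)"
    for N and a b :: "nat \<Rightarrow> real"
  proof -
    have "(\<Sum>i<N. dist (\<gamma> (a i)) (\<gamma> (b i))) \<le> (\<Sum>i<N. (C + 1) * (b i - a i))"
    proof (rule sum_mono)
      fix i assume i: "i \<in> {..<N}"
      then have "dist (\<gamma> (a i)) (\<gamma> (b i)) \<le> C * dist (a i) (b i)"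
        using ab by (intro lipschitz_onD[OF assms]) auto
      also have "\<dots> \<le> (C + 1) * (b i - a i)" using ab i C by (auto simp: dist_real_def intro!: mult_right_mono)
      finally show "dist (\<gamma> (a i)) (\<gamma> (b i)) \<le> (C + 1) * (b i - a i)" .
    qed
    also have "\<dots> = (C + 1) * (\<Sum>i<N. b i - a i)" by (rule sum_distrib_left[symmetric])
    also have "\<dots> < (C + 1) * (\<epsilon> / (C + 1))" using sum C by (intro mult_strict_left_mono) auto
    finally show ?thesis using C by simp
  qed
  show "\<exists>\<delta>>0. \<forall>(N::nat) a b. (\<forall>i<N. a i \<le> b i \<and> a i \<in> S \<and> b i \<in> S) \<and>
      disjoint_family_on (\<lambda>i. {a i<..<b i}) {..<N} \<and> (\<Sum>i<N. b i - a i) < \<delta> \<longrightarrow>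
      (\<Sum>i<N. dist (\<gamma> (a i)) (\<gamma> (b i))) < \<epsilon>"
  proof (intro exI[of _ "\<epsilon> / (C + 1)"] conjI allI impI)
    show "\<epsilon> / (C + 1) > 0" using \<epsilon> C by simp
    fix N :: nat and a b :: "nat \<Rightarrow> real"
    assume *: "(\<forall>i<N. a i \<le> b i \<and> a i \<in> S \<and> b i \<in> S) \<and>
      disjoint_family_on (\<lambda>i. {a i<..<b i}) {..<N} \<and> (\<Sum>i<N. b i - a i) < \<epsilon> / (C + 1)"
    then have "\<forall>i<N. a i \<le> b i \<and> a i \<in> S \<and> b i \<in> S" "(\<Sum>i<N. b i - a i) < \<epsilon> / (C + 1)"
      by blast+
    then show "(\<Sum>i<N. dist (\<gamma> (a i)) (\<gamma> (b i))) < \<epsilon>" by (rule bound)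
  qed
qed

section \<open>Compactness and semicontinuity of conservative fields\<close>

lemma conservative_field_bounded_on_compact:
  assumes D: "conservative_field f D" and K: "compact K"
  obtains B where "\<And>X G. X \<in> K \<Longrightarrow> G \<in> D X \<Longrightarrow> norm G \<le> B"
proof -
  have "\<forall>X. \<exists>V. open V \<and> X \<in> V \<and> bounded (\<Union>Y\<in>V. D Y)"
    using D by (simp add: conservative_field_def)
  then obtain V where V: "\<And>X. open (V X)" "\<And>X. X \<in> V X" "\<And>X. bounded (\<Union>Y\<in>V X. D Y)"
    by metis
  obtain F where F: "F \<subseteq> K" "finite F" "K \<subseteq> (\<Union>X\<in>F. V X)"
    using compactE_image[OF K, of K V] V by blast
  have "bounded (\<Union>X\<in>F. \<Union>Y\<in>V X. D Y)" using F V(3) by (intro bounded_UN) auto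
  then obtain B where "\<And>G. G \<in> (\<Union>X\<in>F. \<Union>Y\<in>V X. D Y) \<Longrightarrow> norm G \<le> B"
    by (auto simp: bounded_iff)
  then show thesis using that F(3) by blast
qed

lemma conservative_field_closed_graph:
  assumes D: "conservative_field f D" and "\<And>k. G k \<in> D (X k)" "X \<longlonglongrightarrow> x" "G \<longlonglongrightarrow> g"
  shows "g \<in> D x"
proof -
  have "closed {(X, Y). Y \<in> D X}" using D by (simp add: conservative_field_def)
  moreover have "(\<lambda>k. (X k, G k)) \<longlonglongrightarrow> (x, g)" using assms by (intro tendsto_Pair)
  ultimately have "(x, g) \<in> {(X, Y). Y \<in> D X}"
    using assms(2) closed_sequentially[of "{(X, Y). Y \<in> D X}" "\<lambda>k. (X k, G k)"] by blast
  then show ?thesis by simp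
qed

text \<open>Otherwise there are values outside \<open>U\<close> over points tending to
  \<open>x\<close>. Local boundedness gives them a cluster value, which the closed graph places in
  \<open>D x\<close> and openness of \<open>U\<close> places outside \<open>U\<close>.\<close>

lemma conservative_field_upper_semicontinuous:
  assumes D: "conservative_field f D" and U: "open U" "D x \<subseteq> U"
  obtains \<rho> where "\<rho> > 0" "\<And>y. dist y x < \<rho> \<Longrightarrow> D y \<subseteq> U"
proof (rule ccontr)
  assume "\<not> thesis"
  then have "\<forall>k. \<exists>y. dist y x < inverse (real (Suc k)) \<and> \<not> D y \<subseteq> U"
    using that by (metis inverse_positive_iff_positive of_nat_0_less_iff zero_less_Suc)
  then obtain y where y: "\<And>k. dist (y k) x < inverse (real (Suc k))" "\<And>k. \<not> D (y k) \<subseteq> U"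
    by metis
  then obtain g where g: "\<And>k. g k \<in> D (y k)" "\<And>k. g k \<notin> U" 
    unfolding subset_iff by metis
  have yx: "y \<longlonglongrightarrow> x"
    using y(1) by (intro metric_tendsto_imp_tendsto[OF LIMSEQ_inverse_real_of_nat])
      (auto intro!: always_eventually less_imp_le)
  have "y k \<in> cball x 1" for k
    using y(1)[of k] le_imp_inverse_le[of 1 "real (Suc k)"] by (simp add: dist_commute)
  moreover obtain B where "\<And>X G. X \<in> cball x 1 \<Longrightarrow> G \<in> D X \<Longrightarrow> norm G \<le> B"
    using conservative_field_bounded_on_compact[OF D compact_cball] by blast
  ultimately have "g k \<in> cball 0 B" for k using g(1) unfolding mem_cball_0 by blast
  then obtain l r where r: "strict_mono r" "(g \<circ> r) \<longlonglongrightarrow> l"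
    using compact_cball[of 0 B] unfolding compact_def by metis
  have "l \<in> D x"
    using conservative_field_closed_graph[OF D _ LIMSEQ_subseq_LIMSEQ[OF yx r(1)] r(2)] g(1) by simp
  moreover have "l \<in> - U"
    using closed_sequentially[OF _ _ r(2), of "- U"] U(1) g(2) by (simp add: closed_Compl)
  ultimately show False using U by blast
qed

text \<open>The recursion in increment form with a chosen polar factor \<open>P t\<close>: an Euler
  step for the differential inclusion, except that \<open>P t\<close> is evaluated at the updated
  momentum.\<close>

locale muon =
  fixes f :: "real ^ 'n ^ 'm \<Rightarrow> real"
    and D :: "real ^ 'n ^ 'm \<Rightarrow> (real ^ 'n ^ 'm) set"
    and \<tau> :: real and \<eta> \<delta> \<sigma> :: "nat \<Rightarrow> real"
    and W M G P :: "nat \<Rightarrow> real ^ 'n ^ 'm"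
    and W_bd \<sigma>_bd :: real
  assumes f_cont: "continuous_on UNIV f"
    and cons: "conservative_field f D"
    and convex: "\<And>X. convex (D X)"
    and tau: "\<tau> > 0"
    and eta_pos: "\<And>t. \<eta> t > 0"
    and eta_lim: "\<eta> \<longlonglongrightarrow> 0"
    and eta_div: "filterlim (\<lambda>N. \<Sum>t<N. \<eta> t) at_top sequentially"
    and delta: "\<And>t. 0 \<le> \<delta> t" "\<And>t. \<delta> t \<le> 1"
    and delta_lim: "\<delta> \<longlonglongrightarrow> 0"
    and sigma: "\<And>t. 0 \<le> \<sigma> t" "\<And>t. \<sigma> t \<le> \<sigma>_bd"
    and G_in: "\<And>t. G t \<in> D (W t)"
    and M_Suc: "\<And>t. M (Suc t) = M t + (\<tau> * \<eta> t) *\<^sub>R (G t - M t)"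
    and P_polar: "\<And>t. P t \<in> polar (\<delta> t) (normalized (\<sigma> t) (M (Suc t)))"
    and W_Suc: "\<And>t. W (Suc t) = W t - \<eta> t *\<^sub>R P t"
    and W_bounded: "\<And>t. norm (W t) \<le> W_bd"
begin

abbreviation z where "z n \<equiv> (W n, M n)"

section \<open>A priori bounds for the iterates\<close>

lemma norm_P_le: "norm (P t) \<le> 2 * real (CARD('m) * CARD('n))"
proof -
  have "norm (P t /\<^sub>R (1 + \<delta> t)) \<le> CARD('m) * CARD('n)"
    by (intro op_unit_ball_norm_le polar_op_bound[OF P_polar delta(1)])
  then have "norm (P t) \<le> (1 + \<delta> t) * real (CARD('m) * CARD('n))"
    using delta(1)[of t] by (simp add: field_simps)
  also have "\<dots> \<le> 2 * real (CARD('m) * CARD('n))"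
    using delta(2)[of t] by (intro mult_right_mono) auto
  finally show ?thesis .
qed

lemma G_bounded: obtains K where "\<And>t. norm (G t) \<le> K"
proof -
  obtain B where "\<And>X G. X \<in> cball 0 W_bd \<Longrightarrow> G \<in> D X \<Longrightarrow> norm G \<le> B"
    using conservative_field_bounded_on_compact[OF cons compact_cball] by blast
  then show thesis using that G_in W_bounded by (metis mem_cball_0)
qed

text \<open>Early on \<open>\<tau> * \<eta> t\<close> may exceed 1. Once it is below 1 the update is
  a convex combination of \<open>M t\<close> and \<open>G t\<close>, which preserves the ball of
  radius \<open>B\<close>; the maximum also takes in the finitely many earlier norms.\<close>

lemma M_bounded: obtains B where "\<And>t. norm (M t) \<le> B"
proof -
  obtain K where K: "\<And>t. norm (G t) \<le> K" using G_bounded by blast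
  have "(\<lambda>t. \<tau> * \<eta> t) \<longlonglongrightarrow> \<tau> * 0" by (intro tendsto_mult_left eta_lim)
  then have "\<forall>\<^sub>F t in sequentially. \<tau> * \<eta> t < 1" by (rule order_tendstoD) simp
  then obtain t0 where t0: "\<And>t. t \<ge> t0 \<Longrightarrow> \<tau> * \<eta> t < 1" by (auto simp: eventually_sequentially)
  define B where "B = Max (insert K ((\<lambda>t. norm (M t)) ` {..t0}))"
  have small: "norm (M t) \<le> B" if "t \<le> t0" for t
    unfolding B_def using that by (intro Max_ge) auto
  have KB: "K \<le> B" unfolding B_def by (intro Max_ge) auto
  have "norm (M (t0 + j)) \<le> B" for j
  proof (induction j)
    case 0
    then show ?case using small[of t0] by simp
  next
    case (Suc j)
    define a where "a = \<tau> * \<eta> (t0 + j)"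
    have a: "0 \<le> a" "a \<le> 1" using t0[of "t0 + j"] tau eta_pos[of "t0 + j"] by (auto simp: a_def)
    have "M (t0 + Suc j) = (1 - a) *\<^sub>R M (t0 + j) + a *\<^sub>R G (t0 + j)"
      using M_Suc[of "t0 + j"] unfolding a_def[symmetric] by (simp add: algebra_simps)
    also have "norm \<dots> \<le> (1 - a) * norm (M (t0 + j)) + a * norm (G (t0 + j))"
      using norm_triangle_ineq[of "(1 - a) *\<^sub>R M (t0 + j)" "a *\<^sub>R G (t0 + j)"] a by simp
    also have "\<dots> \<le> (1 - a) * B + a * B"
      using a Suc K[of "t0 + j"] KB by (intro add_mono mult_left_mono) auto
    finally show ?case by (simp add: algebra_simps)
  qed
  then have "norm (M t) \<le> B" for t
    using small by (metis le_add_diff_inverse nat_le_linear)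
  then show thesis using that by blast
qed

lemma step_bounded: obtains L where "\<And>t. norm (z (Suc t) - z t) \<le> L * \<eta> t"
proof -
  obtain K where K: "\<And>t. norm (G t) \<le> K" using G_bounded by blast
  obtain B where B: "\<And>t. norm (M t) \<le> B" using M_bounded by blast
  have "norm (z (Suc t) - z t) \<le> (2 * real (CARD('m) * CARD('n)) + \<tau> * (K + B)) * \<eta> t" for t
  proof -
    have "norm (z (Suc t) - z t) \<le> norm (\<eta> t *\<^sub>R P t) + norm ((\<tau> * \<eta> t) *\<^sub>R (G t - M t))"
      using norm_Pair_le[of "- (\<eta> t *\<^sub>R P t)" "(\<tau> * \<eta> t) *\<^sub>R (G t - M t)"]
      by (simp add: W_Suc M_Suc)
    also have "\<dots> \<le> \<eta> t * (2 * real (CARD('m) * CARD('n))) + (\<tau> * \<eta> t) * (K + B)"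
      using norm_P_le[of t] K[of t] B[of t] norm_triangle_ineq4[of "G t" "M t"] tau eta_pos[of t]
      by (auto simp del: of_nat_mult intro!: add_mono mult_left_mono)
    finally show ?thesis by (simp add: algebra_simps)
  qed
  then show thesis using that by blast
qed

text \<open>This makes \<open>- fst d / T\<close> a subgradient of the nuclear norm at
  \<open>snd (Z s)\<close>. Each fixed \<open>Y\<close> contributes one half-space condition,
  supplied by \<open>polar_approx_subgradient\<close>.\<close>

lemma limit_subgradient:
  assumes "limit_curve \<eta> z L T p m Z" and s: "0 < s" "s < 1"
    and deriv: "(Z has_vector_derivative d) (at s)"
  shows "- fst d \<bullet> (Y - snd (Z s)) \<le> T * (nuclear_norm Y - nuclear_norm (snd (Z s)))"
proof -
  interpret limit_curve \<eta> z L T p m Z by fact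
  define \<nu> where "\<nu> = real (CARD('m) * CARD('n))"
  define \<mu> where "\<mu> = snd (Z s)"
  have \<nu>: "\<nu> > 0" by (simp add: \<nu>_def)
  obtain B where B: "\<And>t. norm (M t) \<le> B" using M_bounded by blast
  define R where "R = \<bar>nuclear_norm Y\<bar> + (B + \<sigma>_bd) * real CARD('m)"
  have "(- (Y - \<mu>), 0) \<bullet> d \<le> T * (nuclear_norm Y - nuclear_norm \<mu>)"
  proof (rule derivative_halfspace[OF s deriv])
    fix \<epsilon> :: real assume \<epsilon>: "\<epsilon> > 0"
    \<comment> \<open>Error budget: of the factor 3, two parts come from the bound on
      \<open>P n\<close> and one from the Lipschitz constant of the nuclear norm;
      \<open>\<delta> n * R\<close> is the inexactness. The radius
      \<open>\<epsilon> / (6 * \<nu>)\<close> accounts for the other half of \<epsilon>.\<close>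
    have "(\<lambda>n. 3 * \<nu> * (L * \<eta> n) + \<delta> n * R) \<longlonglongrightarrow> 3 * \<nu> * (L * 0) + 0 * R"
      by (intro tendsto_intros eta_lim delta_lim)
    then have "\<forall>\<^sub>F n in sequentially. 3 * \<nu> * (L * \<eta> n) + \<delta> n * R < \<epsilon> / 2"
      by (rule order_tendstoD) (use \<epsilon> in simp)
    then obtain n0 where n0: "\<And>n. n \<ge> n0 \<Longrightarrow> 3 * \<nu> * (L * \<eta> n) + \<delta> n * R < \<epsilon> / 2"
      by (auto simp: eventually_sequentially)
    show "\<exists>\<rho>>0. \<exists>n0. \<forall>n\<ge>n0. dist (z n) (Z s) < \<rho> \<longrightarrow>
      (- (Y - \<mu>), 0) \<bullet> (z (Suc n) - z n) \<le> \<eta> n * (nuclear_norm Y - nuclear_norm \<mu> + \<epsilon>)"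
    proof (intro exI[of _ "\<epsilon> / (6 * \<nu>)"] exI[of _ n0] conjI allI impI)
      show "\<epsilon> / (6 * \<nu>) > 0" using \<epsilon> \<nu> by simp
      fix n assume n: "n0 \<le> n" and close: "dist (z n) (Z s) < \<epsilon> / (6 * \<nu>)"
      \<comment> \<open>\<open>P n\<close> belongs to \<open>M (Suc n)\<close>, while closeness is
        known for index \<open>n\<close>; the shift costs one step.\<close>
      have "norm (M (Suc n) - \<mu>) \<le> dist (z (Suc n)) (Z s)"
        by (metis \<mu>_def dist_norm dist_snd_le snd_conv)
      also have "\<dots> \<le> norm (z (Suc n) - z n) + dist (z n) (Z s)"
        using dist_triangle[of "z (Suc n)" "Z s" "z n"] by (simp add: dist_norm)
      also have "\<dots> \<le> L * \<eta> n + \<epsilon> / (6 * \<nu>)" using step[of n] close by simp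
      finally have "3 * \<nu> * norm (M (Suc n) - \<mu>) \<le> 3 * \<nu> * (L * \<eta> n + \<epsilon> / (6 * \<nu>))"
        using \<nu> by (intro mult_left_mono) auto
      also have "\<dots> = 3 * \<nu> * (L * \<eta> n) + \<epsilon> / 2" using \<nu> by (simp add: field_simps)
      finally have near: "3 * \<nu> * norm (M (Suc n) - \<mu>) \<le> 3 * \<nu> * (L * \<eta> n) + \<epsilon> / 2" .
      have "P n \<bullet> (Y - M (Suc n)) \<le> nuclear_norm Y - nuclear_norm (M (Suc n))
          + \<delta> n * (nuclear_norm Y + (norm (M (Suc n)) + \<sigma> n) * real CARD('m))"
        by (intro polar_approx_subgradient P_polar delta sigma)
      also have "\<dots> \<le> nuclear_norm Y - nuclear_norm (M (Suc n)) + \<delta> n * R"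
        unfolding R_def using delta(1)[of n] B[of "Suc n"] sigma(2)[of n]
        by (intro add_left_mono mult_left_mono add_mono mult_right_mono) auto
      finally have 1: "P n \<bullet> (Y - M (Suc n)) \<le> nuclear_norm Y - nuclear_norm (M (Suc n)) + \<delta> n * R" .
      have 2: "nuclear_norm \<mu> - nuclear_norm (M (Suc n)) \<le> \<nu> * norm (M (Suc n) - \<mu>)"
        using nuclear_norm_lipschitz[of "M (Suc n)" \<mu>] by (simp add: \<nu>_def)
      have "P n \<bullet> (M (Suc n) - \<mu>) \<le> norm (P n) * norm (M (Suc n) - \<mu>)" by (rule norm_cauchy_schwarz)
      also have "\<dots> \<le> 2 * \<nu> * norm (M (Suc n) - \<mu>)"
        unfolding \<nu>_def by (intro mult_right_mono norm_P_le) auto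
      finally have "P n \<bullet> (Y - \<mu>) \<le> nuclear_norm Y - nuclear_norm \<mu> + \<epsilon>"
        using 1 2 near n0[OF n] by (simp add: inner_diff_right)
      from mult_left_mono[OF this, of "\<eta> n"]
      show "(- (Y - \<mu>), 0) \<bullet> (z (Suc n) - z n) \<le> \<eta> n * (nuclear_norm Y - nuclear_norm \<mu> + \<epsilon>)"
        using eta_pos[of n] by (simp add: W_Suc inner_commute less_imp_le algebra_simps)
    qed
  qed
  then show ?thesis by (cases d) (simp add: \<mu>_def inner_commute algebra_simps)
qed

text \<open>The point is the \<open>v\<close> with \<open>M' = \<tau> * T * (v - M)\<close> along
  the curve. Were it outside the closed convex value, a hyperplane would separate it; upper
  semicontinuity puts all \<open>G n\<close> with \<open>W n\<close> nearby on the far side, and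
  averaging puts \<open>v\<close> there too.\<close>

lemma limit_field:
  assumes "limit_curve \<eta> z L T p m Z" and s: "0 < s" "s < 1"
    and deriv: "(Z has_vector_derivative d) (at s)"
  shows "snd d /\<^sub>R (\<tau> * T) + snd (Z s) \<in> D (fst (Z s))"
proof (rule ccontr)
  interpret limit_curve \<eta> z L T p m Z by fact
  define \<mu> where "\<mu> = snd (Z s)"
  define v where "v = snd d /\<^sub>R (\<tau> * T) + \<mu>"
  assume "\<not> ?thesis"
  then have "v \<notin> D (fst (Z s))" by (simp add: v_def \<mu>_def)
  moreover have "closed (D (fst (Z s)))"
    using cons by (simp add: conservative_field_def compact_imp_closed)
  ultimately obtain a b where ab: "a \<bullet> v < b" "\<And>x. x \<in> D (fst (Z s)) \<Longrightarrow> a \<bullet> x > b"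
    using separating_hyperplane_closed_point[OF convex] by metis
  obtain \<rho> where \<rho>: "\<rho> > 0" "\<And>y. dist y (fst (Z s)) < \<rho> \<Longrightarrow> D y \<subseteq> {x. a \<bullet> x > b}"
    using conservative_field_upper_semicontinuous[OF cons open_halfspace_gt[of b a], of "fst (Z s)"] ab(2)
    by (auto simp: subset_iff)
  have "(0, - a) \<bullet> d \<le> T * (\<tau> * (a \<bullet> \<mu> - b))"
  proof (rule derivative_halfspace[OF s deriv])
    fix \<epsilon> :: real assume \<epsilon>: "\<epsilon> > 0"
    define \<rho>' where "\<rho>' = \<epsilon> / (\<tau> * (norm a + 1))"
    have \<rho>': "\<rho>' > 0" using \<epsilon> tau by (simp add: \<rho>'_def add_nonneg_pos)
    show "\<exists>\<rho>>0. \<exists>n0. \<forall>n\<ge>n0. dist (z n) (Z s) < \<rho> \<longrightarrow>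
      (0, - a) \<bullet> (z (Suc n) - z n) \<le> \<eta> n * (\<tau> * (a \<bullet> \<mu> - b) + \<epsilon>)"
    proof (intro exI[of _ "min \<rho> \<rho>'"] exI[of _ 0] conjI allI impI)
      show "min \<rho> \<rho>' > 0" using \<rho> \<rho>' by simp
      fix n assume close: "dist (z n) (Z s) < min \<rho> \<rho>'"
      have "dist (W n) (fst (Z s)) < \<rho>" using dist_fst_le[of "z n" "Z s"] close by simp
      then have 1: "a \<bullet> G n > b" using \<rho>(2) G_in by blast
      have "norm (M n - \<mu>) < \<rho>'"
        using dist_snd_le[of "z n" "Z s"] close by (simp add: dist_norm \<mu>_def)
      then have "norm a * norm (M n - \<mu>) \<le> (norm a + 1) * \<rho>'"
        by (intro mult_mono) auto
      then have "\<tau> * (a \<bullet> (M n - \<mu>)) \<le> \<tau> * ((norm a + 1) * \<rho>')"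
        using norm_cauchy_schwarz[of a "M n - \<mu>"] tau by (intro mult_left_mono) auto
      also have "\<dots> = \<epsilon>" using tau by (simp add: \<rho>'_def add_nonneg_eq_0_iff)
      finally have 2: "\<tau> * (a \<bullet> (M n - \<mu>)) \<le> \<epsilon>" .
      have "\<tau> * b \<le> \<tau> * (a \<bullet> G n)" using 1 tau by simp
      with 2 have "\<tau> * (a \<bullet> M n - a \<bullet> G n) \<le> \<tau> * (a \<bullet> \<mu> - b) + \<epsilon>"
        by (simp add: inner_diff_right right_diff_distrib)
      from mult_left_mono[OF this, of "\<eta> n"]
      show "(0, - a) \<bullet> (z (Suc n) - z n) \<le> \<eta> n * (\<tau> * (a \<bullet> \<mu> - b) + \<epsilon>)"
        using eta_pos[of n] by (simp add: M_Suc inner_diff_right less_imp_le algebra_simps)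
    qed
  qed
  then have "(\<tau> * T) * b \<le> a \<bullet> snd d + (\<tau> * T) * (a \<bullet> \<mu>)"
    by (cases d) (simp add: algebra_simps)
  also have "\<dots> = (\<tau> * T) * (a \<bullet> v)"
    using tau T_pos by (simp add: v_def inner_add_right field_simps)
  finally show False using ab(1) tau T_pos by simp
qed

text \<open>The loss is \<open>T\<close> times the integral of the nuclear norm. If it vanished, the
  momentum would be zero along the whole curve, its derivative too, so 0 would lie in the field at
  almost every time, and the closed graph would carry this back to time 0.\<close>

lemma descent:
  assumes lc: "limit_curve \<eta> z L T p m Z" and noncrit: "\<not> (snd (Z 0) = 0 \<and> 0 \<in> D (fst (Z 0)))"
  shows "f (fst (Z 1)) + nuclear_norm (snd (Z 1)) / \<tau> < f (fst (Z 0)) + nuclear_norm (snd (Z 0)) / \<tau>"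
proof -
  interpret limit_curve \<eta> z L T p m Z by fact
  define w where "w s = fst (Z s)" for s
  define \<mu> where "\<mu> s = snd (Z s)" for s
  define \<nu> where "\<nu> = real (CARD('m) * CARD('n))"
  obtain g N where g_meas: "g \<in> borel_measurable borel" and N: "negligible N"
    and g: "\<And>s. s \<notin> N \<Longrightarrow> (Z has_vector_derivative g s) (at s)"
    using lipschitz_imp_AE_vector_derivative[OF curve_lipschitz] by metis
  have w_lip: "(L * T)-lipschitz_on UNIV w" and \<mu>_lip: "(L * T)-lipschitz_on UNIV \<mu>"
    using curve_lipschitz dist_fst_le dist_snd_le order_trans
    unfolding w_def \<mu>_def lipschitz_on_def by metis+
  have \<mu>_cont: "continuous_on S \<mu>" for S
    using lipschitz_on_continuous_on[OF \<mu>_lip] continuous_on_subset by blast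
  have w_cont: "continuous_on S w" for S
    using lipschitz_on_continuous_on[OF w_lip] continuous_on_subset by blast
  have nn_lip: "(\<nu> * (L * T))-lipschitz_on UNIV (\<lambda>s. nuclear_norm (\<mu> s))"
  proof (rule lipschitz_onI)
    fix s s' :: real
    have "\<bar>nuclear_norm (\<mu> s) - nuclear_norm (\<mu> s')\<bar> \<le> \<nu> * norm (\<mu> s - \<mu> s')"
      unfolding \<nu>_def by (rule nuclear_norm_lipschitz)
    also have "\<dots> \<le> \<nu> * (L * T * dist s s')"
      using lipschitz_onD[OF \<mu>_lip, of s s'] by (intro mult_left_mono) (auto simp: dist_norm \<nu>_def)
    finally show "dist (nuclear_norm (\<mu> s)) (nuclear_norm (\<mu> s')) \<le> \<nu> * (L * T) * dist s s'"
      by (simp add: dist_real_def mult_ac)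
  qed (use lipschitz_on_nonneg[OF \<mu>_lip] in \<open>auto simp: \<nu>_def\<close>)
  have nn_cont: "continuous_on S (\<lambda>s. nuclear_norm (\<mu> s))" for S
    using lipschitz_on_continuous_on[OF nn_lip] continuous_on_subset by blast
  \<comment> \<open>The nuclear norm is not differentiable, so there is no chain rule; its
    composition with the Lipschitz curve is differentiated on its own.\<close>
  obtain h N' where h_meas: "h \<in> borel_measurable borel" and N': "negligible N'"
    and h_bound: "\<And>s. norm (h s) \<le> \<nu> * (L * T)"
    and h: "\<And>s. s \<notin> N' \<Longrightarrow> ((\<lambda>s. nuclear_norm (\<mu> s)) has_vector_derivative h s) (at s)"
    and h_int: "\<And>a b. a \<le> b \<Longrightarrow> (h has_integral nuclear_norm (\<mu> b) - nuclear_norm (\<mu> a)) {a..b}"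
    using lipschitz_imp_AE_vector_derivative[OF nn_lip] by metis
  define v where "v s = snd (g s) /\<^sub>R (\<tau> * T) + \<mu> s" for s
  define k where "k s = - h s / \<tau> - T * nuclear_norm (\<mu> s)" for s
  \<comment> \<open>Endpoints are added because the limit inclusions hold at interior times.\<close>
  define N0 where "N0 = N \<union> N' \<union> {0, 1}"
  have N0: "negligible N0" using N N' by (auto simp: N0_def)
  have N0D: "0 < s" "s < 1" "s \<notin> N" "s \<notin> N'" if "s \<in> {0..1}" "s \<notin> N0" for s
    using that by (auto simp: N0_def)
  have v_in: "v s \<in> D (w s)" if "s \<in> {0..1}" "s \<notin> N0" for s
    using limit_field[OF lc _ _ g] N0D[OF that] by (simp add: v_def w_def \<mu>_def)
  have fst_g: "(w has_vector_derivative fst (g s)) (at s)" and snd_g: "(\<mu> has_vector_derivative snd (g s)) (at s)"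
    if "s \<notin> N" for s
    using bounded_linear.has_vector_derivative[OF bounded_linear_fst g[OF that]]
      bounded_linear.has_vector_derivative[OF bounded_linear_snd g[OF that]]
    by (simp_all add: w_def[abs_def] \<mu>_def[abs_def])
  have k_eq: "vector_derivative w (at s within {0..1}) \<bullet> v s = k s" if s: "s \<in> {0..1}" "s \<notin> N0" for s
  proof -
    note s' = N0D[OF s]
    have vd: "vector_derivative w (at s within {0..1}) = fst (g s)"
      using vector_derivative_within_cbox[of 0 1 s w "fst (g s)"] s'
        has_vector_derivative_at_within[OF fst_g[OF s'(3)]] by simp
    have sub: "- fst (g s) \<bullet> (Y - \<mu> s) \<le> T * (nuclear_norm Y - nuclear_norm (\<mu> s))" for Y
      unfolding \<mu>_def using limit_subgradient[OF lc s'(1,2) g[OF s'(3)]] .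
    \<comment> \<open>Testing the subgradient inequality at 0 and at twice the momentum gives both
      halves of Euler's identity.\<close>
    have "nuclear_norm (2 *\<^sub>R \<mu> s) - nuclear_norm (\<mu> s) \<le> nuclear_norm (\<mu> s)"
      using nuclear_norm_scale_le[of 2 "\<mu> s"] by simp
    then have "T * (nuclear_norm (2 *\<^sub>R \<mu> s) - nuclear_norm (\<mu> s)) \<le> T * nuclear_norm (\<mu> s)"
      using T_pos by simp
    moreover have "2 *\<^sub>R \<mu> s - \<mu> s = \<mu> s" by (simp add: scaleR_2)
    ultimately have euler: "fst (g s) \<bullet> \<mu> s = - T * nuclear_norm (\<mu> s)"
      using sub[of 0] sub[of "2 *\<^sub>R \<mu> s"] by simp
    \<comment> \<open>The subgradient inequality says that \<open>\<phi>\<close> is minimal at \<open>s\<close>; this yields \<open>N(M)'\<close>.\<close>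
    define \<phi> where "\<phi> y = T * nuclear_norm (\<mu> y) + fst (g s) \<bullet> \<mu> y" for y
    have "((\<lambda>y. nuclear_norm (\<mu> y)) has_real_derivative h s) (at s)"
      using h[OF s'(4)] by (simp add: has_real_derivative_iff_has_vector_derivative)
    moreover have "((\<lambda>y. fst (g s) \<bullet> \<mu> y) has_real_derivative fst (g s) \<bullet> snd (g s)) (at s)"
      using bounded_linear.has_vector_derivative[OF bounded_linear_inner_right snd_g[OF s'(3)]]
      by (simp add: has_real_derivative_iff_has_vector_derivative)
    ultimately have "(\<phi> has_real_derivative T * h s + fst (g s) \<bullet> snd (g s)) (at s)"
      unfolding \<phi>_def by (auto intro!: derivative_eq_intros)
    moreover have "\<phi> s \<le> \<phi> y" for y
      using sub[of "\<mu> y"] by (simp add: \<phi>_def inner_diff_right algebra_simps)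
    ultimately have "T * h s + fst (g s) \<bullet> snd (g s) = 0"
      using DERIV_local_min[of \<phi> _ s 1] by simp
    then have "fst (g s) \<bullet> snd (g s) = - T * h s" by simp
    then have "fst (g s) \<bullet> (snd (g s) /\<^sub>R (\<tau> * T)) = - h s / \<tau>"
      using T_pos tau by (simp add: field_simps)
    then show ?thesis by (simp add: vd v_def inner_add_right euler k_def)
  qed
  have meas: "u \<in> borel_measurable (lebesgue_on {0..1})" if "u \<in> borel_measurable borel"
    for u :: "real \<Rightarrow> 'c::euclidean_space"
    using that by (simp add: measurable_completion measurable_restrict_space1)
  have "\<mu> \<in> borel_measurable borel" using \<mu>_cont by (rule borel_measurable_continuous_onI)
  moreover have "(\<lambda>s. snd (g s)) \<in> borel_measurable borel"
    using g_meas by (intro borel_measurable_continuous_on[of snd] continuous_on_snd continuous_on_id)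
  ultimately have v_meas: "v \<in> borel_measurable (lebesgue_on {0..1})"
    unfolding v_def by (intro meas borel_measurable_add borel_measurable_scaleR borel_measurable_const) 
  have nn_meas: "(\<lambda>s. nuclear_norm (\<mu> s)) \<in> borel_measurable borel"
    using nn_cont by (rule borel_measurable_continuous_onI)
  have "k \<in> borel_measurable borel"
    unfolding k_def using h_meas nn_meas
    by (intro borel_measurable_diff borel_measurable_divide borel_measurable_uminus borel_measurable_times
        borel_measurable_const)
  then have k_meas: "k \<in> borel_measurable (lebesgue_on {0..1})" by (rule meas)
  have "AE s in lebesgue_on {0..1}. v s \<in> D (w s)"
    using N0 v_in by (subst AE_restrict_space_iff) (auto simp: negligible_iff_null_sets intro!: AE_I'[of N0])
  then have "f (w 1) - f (w 0) = (LINT s|lebesgue_on {0..1}. vector_derivative w (at s within {0..1}) \<bullet> v s)"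
    using cons lipschitz_imp_absolutely_continuous_on[OF lipschitz_on_subset[OF w_lip subset_UNIV]] v_meas
    unfolding conservative_field_def by blast
  also have "\<dots> = (LINT s|lebesgue_on {0..1}. k s)"
    by (rule integral_lebesgue_on_negligible_cong[OF _ N0 k_eq k_meas]) auto
  also have "\<dots> = integral {0..1} k"
  proof (rule lebesgue_integral_eq_integral)
    have "bounded ((\<lambda>s. nuclear_norm (\<mu> s)) ` {0..1})"
      by (intro compact_imp_bounded compact_continuous_image nn_cont) simp
    then obtain B where "\<forall>y\<in>(\<lambda>s. nuclear_norm (\<mu> s)) ` {0..1}. norm y \<le> B"
      unfolding bounded_iff by blast
    then have B: "\<bar>nuclear_norm (\<mu> s)\<bar> \<le> B" if "s \<in> {0..1}" for s
      using that by simp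
    have "norm (k s) \<le> \<nu> * (L * T) / \<tau> + T * B" if "s \<in> {0..1}" for s
    proof -
      have "norm (k s) \<le> \<bar>h s\<bar> / \<tau> + T * \<bar>nuclear_norm (\<mu> s)\<bar>"
        using abs_triangle_ineq4[of "- h s / \<tau>" "T * nuclear_norm (\<mu> s)"] tau T_pos
        by (simp add: k_def abs_mult)
      also have "\<dots> \<le> \<nu> * (L * T) / \<tau> + T * B"
        using h_bound[of s] B[OF that] tau T_pos by (intro add_mono divide_right_mono mult_left_mono) auto
      finally show ?thesis .
    qed
    then show "integrable (lebesgue_on {0..1}) k"
      using k_meas by (intro finite_measure.integrable_const_bound[where B = "\<nu> * (L * T) / \<tau> + T * B"])
        (auto intro!: finite_measure_lebesgue_on AE_I2)
  qed auto
  also have "\<dots> = - (nuclear_norm (\<mu> 1) - nuclear_norm (\<mu> 0)) / \<tau> - T * integral {0..1} (\<lambda>s. nuclear_norm (\<mu> s))"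
  proof -
    have "((\<lambda>s. nuclear_norm (\<mu> s)) has_integral integral {0..1} (\<lambda>s. nuclear_norm (\<mu> s))) {0..1}"
      by (intro integrable_integral integrable_continuous_interval nn_cont)
    then have "(k has_integral - (nuclear_norm (\<mu> 1) - nuclear_norm (\<mu> 0)) / \<tau>
        - T * integral {0..1} (\<lambda>s. nuclear_norm (\<mu> s))) {0..1}"
      unfolding k_def by (intro has_integral_diff has_integral_divide has_integral_neg has_integral_mult_right h_int) auto
    then show ?thesis by (rule integral_unique)
  qed
  finally have balance: "f (w 1) + nuclear_norm (\<mu> 1) / \<tau> =
      f (w 0) + nuclear_norm (\<mu> 0) / \<tau> - T * integral {0..1} (\<lambda>s. nuclear_norm (\<mu> s))"
    by (simp add: diff_divide_distrib)
  have nonneg: "nuclear_norm (\<mu> s) \<ge> 0" for s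
    using norm_le_nuclear_norm[of "\<mu> s"] norm_ge_zero[of "\<mu> s"] by linarith
  have "integral {0..1} (\<lambda>s. nuclear_norm (\<mu> s)) \<noteq> 0"
  proof
    assume "integral {0..1} (\<lambda>s. nuclear_norm (\<mu> s)) = 0"
    then have "nuclear_norm (\<mu> s) = 0" if "s \<in> {0..1}" for s
      using integral_eq_0_iff[of 0 1 "\<lambda>s. nuclear_norm (\<mu> s)"] nn_cont nonneg that by auto
    then have \<mu>_0: "\<mu> s = 0" if "s \<in> {0..1}" for s
      using norm_le_nuclear_norm[of "\<mu> s"] that by simp
    have D0: "0 \<in> D (w s)" if s: "s \<in> {0..1}" "s \<notin> N0" for s
    proof -
      have "((\<lambda>y. 0) has_vector_derivative snd (g s)) (at s)"
        by (rule has_vector_derivative_transform_within_open[OF snd_g[OF N0D(3)[OF s]] open_greaterThanLessThan[of 0 1]])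
           (use N0D[OF s] \<mu>_0 in auto)
      then have "snd (g s) = 0"
        using has_vector_derivative_const vector_derivative_unique_at by blast
      then show ?thesis using v_in[OF s] \<mu>_0[OF s(1)] by (simp add: v_def)
    qed
    \<comment> \<open>A null set contains no interval, so good times accumulate at 0.\<close>
    have "\<exists>s. s \<in> {0..1} \<and> s \<notin> N0 \<and> s \<le> inverse (real (Suc j))" for j
    proof (rule ccontr)
      assume no: "\<not> ?thesis"
      have le1: "inverse (real (Suc j)) \<le> 1"
        using le_imp_inverse_le[of 1 "real (Suc j)"] by simp
      have "{0<..<inverse (real (Suc j))} \<subseteq> N0"
      proof
        fix s assume "s \<in> {0<..<inverse (real (Suc j))}"
        then have "s \<in> {0..1}" "s \<le> inverse (real (Suc j))" using le1 by simp_all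
        then show "s \<in> N0" using no by blast
      qed
      then have "negligible {0<..<inverse (real (Suc j))}" using N0 negligible_subset by blast
      then show False using open_not_negligible[of "{0<..<inverse (real (Suc j))}"] by simp
    qed
    then obtain s where s: "\<And>j. s j \<in> {0..1}" "\<And>j. s j \<notin> N0" "\<And>j. s j \<le> inverse (real (Suc j))"
      by metis
    have s_lim: "s \<longlonglongrightarrow> 0"
      by (rule tendsto_sandwich[OF _ _ tendsto_const LIMSEQ_inverse_real_of_nat])
        (use s in \<open>auto intro!: always_eventually\<close>)
    have "(\<lambda>j. w (s j)) \<longlonglongrightarrow> w 0"
      using continuous_on_tendsto_compose[OF w_cont[of UNIV] s_lim] by simp
    then have "0 \<in> D (w 0)"
      by (rule conservative_field_closed_graph[OF cons D0[OF s(1,2)] _ tendsto_const])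
    then show False using noncrit \<mu>_0[of 0] by (simp add: w_def \<mu>_def)
  qed
  moreover have "integral {0..1} (\<lambda>s. nuclear_norm (\<mu> s)) \<ge> 0"
    using nonneg by (intro integral_nonneg integrable_continuous_interval nn_cont)
  ultimately have "T * integral {0..1} (\<lambda>s. nuclear_norm (\<mu> s)) > 0" using T_pos by simp
  then show ?thesis using balance by (simp add: w_def \<mu>_def)
qed

proposition convergence:
  assumes sard: "interior {f X | X. 0 \<in> D X} = {}"
  shows "convergent (\<lambda>t. f (W t))" "M \<longlonglongrightarrow> 0"
    and "\<And>r X. strict_mono r \<Longrightarrow> (W \<circ> r) \<longlonglongrightarrow> X \<Longrightarrow> 0 \<in> D X"
proof -
  define \<Phi> where "\<Phi> x = f (fst x) + nuclear_norm (snd x) / \<tau>" for x :: "(real ^ 'n ^ 'm) \<times> (real ^ 'n ^ 'm)"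
  define C where "C = {x :: (real ^ 'n ^ 'm) \<times> (real ^ 'n ^ 'm). snd x = 0 \<and> 0 \<in> D (fst x)}"
  obtain L where L: "\<And>t. norm (z (Suc t) - z t) \<le> L * \<eta> t" using step_bounded by blast
  obtain B where B: "\<And>t. norm (M t) \<le> B" using M_bounded by blast
  have z_bd: "norm (z t) \<le> W_bd + B" for t
    using norm_Pair_le[of "W t" "M t"] W_bounded[of t] B[of t] by linarith
  have nn_cont: "continuous_on UNIV (nuclear_norm :: real ^ 'n ^ 'm \<Rightarrow> real)"
  proof (rule lipschitz_on_continuous_on)
    show "(real CARD('m) * real CARD('n))-lipschitz_on UNIV (nuclear_norm :: real ^ 'n ^ 'm \<Rightarrow> real)"
      using nuclear_norm_lipschitz by (intro lipschitz_onI) (auto simp: dist_norm)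
  qed
  have "continuous_on UNIV (\<lambda>x :: (real^'n^'m) \<times> (real^'n^'m). f (fst x))"
    by (rule continuous_on_compose2[OF f_cont continuous_on_fst[OF continuous_on_id]]) simp
  moreover have "continuous_on UNIV (\<lambda>x :: (real^'n^'m) \<times> (real^'n^'m). nuclear_norm (snd x))"
    by (rule continuous_on_compose2[OF nn_cont continuous_on_snd[OF continuous_on_id]]) simp
  ultimately have cont: "continuous_on UNIV \<Phi>"
    unfolding \<Phi>_def using tau by (intro continuous_intros) auto
  \<comment> \<open>The nuclear norm vanishes on \<open>C\<close>, so the critical values of \<Phi>
    are exactly those of \<open>f\<close> and the hypothesis on them transfers.\<close>
  have "\<Phi> ` C = {f X | X. 0 \<in> D X}"
    by (force simp: \<Phi>_def C_def image_iff)
  then have sard': "interior (\<Phi> ` C) = {}" using sard by simp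
  have desc: "\<Phi> (Z 1) < \<Phi> (Z 0)" if "limit_curve \<eta> z L T p m Z" "Z 0 \<notin> C" for T p m Z
    using descent[OF that(1)] that(2) by (simp add: \<Phi>_def C_def)
  note lyap = lyapunov_convergence[OF eta_pos eta_lim eta_div L z_bd cont sard']
  have conv: "convergent (\<lambda>t. \<Phi> (z t))" by (rule lyap(1)) (rule desc)
  have cluster: "x \<in> C" if "strict_mono r" "(z \<circ> r) \<longlonglongrightarrow> x" for r x
    by (rule lyap(2)[OF _ that]) (rule desc)
  have sub: "\<exists>l q. strict_mono q \<and> (z \<circ> (r \<circ> q)) \<longlonglongrightarrow> l" for r :: "nat \<Rightarrow> nat"
  proof -
    have "\<forall>t. (z \<circ> r) t \<in> cball 0 (W_bd + B)" using z_bd by simp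
    then have "\<exists>l\<in>cball 0 (W_bd + B). \<exists>q. strict_mono q \<and> ((z \<circ> r) \<circ> q) \<longlonglongrightarrow> l"
      using compact_cball[of "0 :: (real^'n^'m) \<times> (real^'n^'m)" "W_bd + B"]
      unfolding compact_def by blast
    then show ?thesis unfolding o_assoc by blast
  qed
  \<comment> \<open>Along a subsequence staying away from 0, boundedness gives a jointly convergent
    further subsequence; its limit lies in \<open>C\<close>, where the momentum is 0.\<close>
  show M0: "M \<longlonglongrightarrow> 0"
  proof (rule ccontr)
    assume "\<not> M \<longlonglongrightarrow> 0"
    then obtain e where e: "e > 0" "\<not> (\<forall>\<^sub>F t in sequentially. dist (M t) 0 < e)"
      unfolding tendsto_iff by blast
    then have "infinite {t. \<not> dist (M t) 0 < e}"
      by (simp add: cofinite_eq_sequentially[symmetric] eventually_cofinite)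
    then obtain r :: "nat \<Rightarrow> nat" where r: "strict_mono r" "\<And>t. \<not> dist (M (r t)) 0 < e"
      using infinite_enumerate[of "{t. \<not> dist (M t) 0 < e}"] by auto
    obtain l q where q: "strict_mono q" "(z \<circ> (r \<circ> q)) \<longlonglongrightarrow> l" using sub by blast
    have "l \<in> C" using cluster[OF strict_mono_o[OF r(1) q(1)] q(2)] .
    then have "(\<lambda>t. M (r (q t))) \<longlonglongrightarrow> 0" using tendsto_snd[OF q(2)] by (simp add: C_def o_def)
    then have "\<forall>\<^sub>F t in sequentially. dist (M (r (q t))) 0 < e" using e(1) by (rule tendstoD)
    then show False using r(2) by simp
  qed
  show "0 \<in> D X" if r: "strict_mono r" "(W \<circ> r) \<longlonglongrightarrow> X" for r X
  proof -
    have "(z \<circ> r) \<longlonglongrightarrow> (X, 0)"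
      using tendsto_Pair[OF r(2) LIMSEQ_subseq_LIMSEQ[OF M0 r(1)]] by (simp add: o_def)
    then show ?thesis using cluster[OF r(1)] by (auto simp: C_def)
  qed
  obtain l where "(\<lambda>t. \<Phi> (z t)) \<longlonglongrightarrow> l" using conv by (auto simp: convergent_def)
  moreover have "(\<lambda>t. nuclear_norm (M t) / \<tau>) \<longlonglongrightarrow> nuclear_norm 0 / \<tau>"
    using continuous_on_tendsto_compose[OF nn_cont M0] by (intro tendsto_intros) (use tau in auto)
  ultimately have "(\<lambda>t. \<Phi> (z t) - nuclear_norm (M t) / \<tau>) \<longlonglongrightarrow> l - nuclear_norm 0 / \<tau>"
    by (rule tendsto_diff)
  then show "convergent (\<lambda>t. f (W t))" by (auto simp: convergent_def \<Phi>_def)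
qed

end

lemma locally_lipschitz_imp_continuous_on:
  assumes "locally_lipschitz f"
  shows "continuous_on S f"
proof (rule continuous_at_imp_continuous_on, rule ballI)
  fix x
  obtain r L where "r > 0" "L-lipschitz_on (ball x r) f"
    using assms unfolding locally_lipschitz_def by blast
  then have "continuous_on (ball x r) f" "x \<in> ball x r"
    by (auto intro: lipschitz_on_continuous_on)
  then show "isCont f x" by (simp add: continuous_on_eq_continuous_at)
qed

theorem theorem3p2:
  fixes f :: "real ^ 'n ^ 'm \<Rightarrow> real"
    and D :: "real ^ 'n ^ 'm \<Rightarrow> (real ^ 'n ^ 'm) set"
    and \<tau> :: real
    and \<eta> \<delta> \<sigma> \<beta> :: "nat \<Rightarrow> real"
    and W M Mt G :: "nat \<Rightarrow> real ^ 'n ^ 'm"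
  assumes "locally_lipschitz f"
    and "conservative_field f D"
    and "\<And>X. convex (D X)"
    and "interior {f X | X. 0 \<in> D X} = {}"
    and "\<tau> > 0"
    and "\<And>t. \<eta> t > 0"
    and "\<eta> \<longlonglongrightarrow> 0"
    and "filterlim (\<lambda>N. \<Sum>t<N. \<eta> t) at_top sequentially"
    and "\<And>t. \<delta> t \<in> {0..<1}"
    and "\<delta> \<longlonglongrightarrow> 0"
    and "\<And>t. \<sigma> t \<ge> 0"
    and "bdd_above (range \<sigma>)"
    and "\<And>t. \<beta> t = 1 - \<tau> * \<eta> t"
    and "\<And>t. G t \<in> D (W t)"
    and "\<And>t. M (Suc t) = \<beta> t *\<^sub>R M t + (1 - \<beta> t) *\<^sub>R G t"
    and "\<And>t. Mt (Suc t) = normalized (\<sigma> t) (M (Suc t))"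
    and "\<And>t. W (Suc t) \<in> {W t - \<eta> t *\<^sub>R P | P. P \<in> polar (\<delta> t) (Mt (Suc t))}"
    and "bdd_above (range (\<lambda>t. norm (W t)))"
  shows "(\<forall>Wbar r. strict_mono r \<and> (W \<circ> r) \<longlonglongrightarrow> Wbar \<longrightarrow> 0 \<in> D Wbar) \<and>
         M \<longlonglongrightarrow> 0 \<and>
         convergent (\<lambda>t. f (W t)) \<and>
         (convex_on UNIV f \<and> D = convex_subdifferential f \<longrightarrow>
            (\<lambda>t. ereal (f (W t))) \<longlonglongrightarrow> (INF X. ereal (f X)))"
proof -
  have f_cont: "continuous_on UNIV f"
    using assms(1) by (rule locally_lipschitz_imp_continuous_on)
  obtain \<sigma>_bd where \<sigma>_bd: "\<And>t. \<sigma> t \<le> \<sigma>_bd" using assms(12) by (auto simp: bdd_above_def)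
  obtain W_bd where W_bd: "\<And>t. norm (W t) \<le> W_bd" using assms(18) by (auto simp: bdd_above_def)
  have "\<exists>P. W (Suc t) = W t - \<eta> t *\<^sub>R P \<and> P \<in> polar (\<delta> t) (normalized (\<sigma> t) (M (Suc t)))" for t
    using assms(17)[of t] unfolding assms(16) by blast
  then obtain P where P: "\<And>t. W (Suc t) = W t - \<eta> t *\<^sub>R P t"
    "\<And>t. P t \<in> polar (\<delta> t) (normalized (\<sigma> t) (M (Suc t)))" by metis
  have M_Suc: "M (Suc t) = M t + (\<tau> * \<eta> t) *\<^sub>R (G t - M t)" for t
    unfolding assms(15)[of t] assms(13)[of t] by (simp add: algebra_simps)
  interpret muon f D \<tau> \<eta> \<delta> \<sigma> W M G P W_bd \<sigma>_bd
  proof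
    show "0 \<le> \<delta> t" "\<delta> t \<le> 1" for t using assms(9)[of t] by auto
  qed (fact f_cont assms \<sigma>_bd W_bd P M_Suc)+
  note res = convergence[OF assms(4)]
  \<comment> \<open>A cluster point exists by boundedness; a zero subgradient makes it a global
    minimizer. The full sequence of values converges, so its limit is the value there.\<close>
  have "(\<lambda>t. ereal (f (W t))) \<longlonglongrightarrow> (INF X. ereal (f X))" if D: "D = convex_subdifferential f"
  proof -
    have "\<forall>t. W t \<in> cball 0 W_bd" using W_bd by simp
    then obtain X r where r: "strict_mono r" "(W \<circ> r) \<longlonglongrightarrow> X"
      using compact_cball[of "0 :: real ^ 'n ^ 'm" W_bd] unfolding compact_def by metis
    have "0 \<in> D X" using res(3)[OF r] .
    then have min: "f X \<le> f Y" for Y by (simp add: D convex_subdifferential_def)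
    then have inf: "(INF Y. ereal (f Y)) = ereal (f X)"
      by (intro antisym INF_greatest) (auto intro: INF_lower)
    obtain l where l: "(\<lambda>t. f (W t)) \<longlonglongrightarrow> l" using res(1) by (auto simp: convergent_def)
    have "(\<lambda>t. f (W (r t))) \<longlonglongrightarrow> l" using LIMSEQ_subseq_LIMSEQ[OF l r(1)] by (simp add: o_def)
    moreover have "(\<lambda>t. f (W (r t))) \<longlonglongrightarrow> f X"
      using continuous_on_tendsto_compose[OF f_cont r(2)] by simp
    ultimately have "l = f X" by (rule LIMSEQ_unique)
    then show ?thesis using l inf by simp
  qed
  then show ?thesis using res by blast
qed

end
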